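(* Assume that $K_p:=\int_{-\pi}^{\pi}|p^*(\lambda)|^{-2}\,d\lambda<\infty$. Then the MISE of the estimator $\widehat f_{\infty,n}$ has rate $n^{-1}$ over $\mathbb{H}_1$, and this rate is minimax over any class $\mathcal{C}$ included in $\mathbb{H}_1$ and containing a line segment $[f_0,f_1]$ for distinct $f_0$ and $f_1$ in $\mathbb{H}_1$. More precisely, there are universal positive constants $K_1$ and $K_2$ such that, for any $f_0$ and $f_1$ in $\mathbb{H}_1$ and any positive integer $n$, $$c_0(K_1+K_2c_1n)^{-1}\le\inf_{\hat f\in\mathcal{S}_n}\sup_{f\in[f_0,f_1]}\mathbb{E}_f\|\hat f-f\|_{\mathbb{H}}^2\le\sup_{f\in\mathbb{H}_1}\mathbb{E}_f\|\widehat f_{\infty,n}-f\|_{\mathbb{H}}^2\le\frac{K_p}{2\pi n},$$ where $c_0:=\sum_{l\in\mathbb{Z}}(f_1(l)-f_0(l))^2$ and $c_1:=\sum_{l\in\mathbb{Z}}|\pi_{f_1}(l)-\pi_{f_0}(l)|$.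
   Context: Discrete deconvolution. $\mathcal{X}=\Theta=\mathbb{Z}$, $\nu$ is counting measure on $\mathbb{Z}$, $\mathbb{H}=\ell^2(\mathbb{Z})$ (real), and $\mathbb{H}_1$ is the set of probability mass functions on $\mathbb{Z}$. $p$ is a fixed known probability mass function on $\mathbb{Z}$ and $\pi_\theta(k)=p(k-\theta)$; for $f\in\mathbb{H}_1$, $\pi_f(k)=\sum_{\theta\in\mathbb{Z}}p(k-\theta)f(\theta)$. $\mathbb{E}_f$ is expectation when $X_1,\dots,X_n$ are i.i.d. from $\pi_f$; $\mathcal{S}_n$ is the set of measurable functions from $\mathbb{Z}^n$ to $\mathbb{H}$. $p^*(\lambda)=\sum_{k\in\mathbb{Z}}p(k)e^{-ik\lambda}$, $\lambda\in(-\pi,\pi]$. With $P_n\mathbf{1}_k=\frac1n\#\{j\le n:X_j=k\}$ and $P_n^*(\lambda)=\sum_{k\in\mathbb{Z}}(P_n\mathbf{1}_k)e^{-ik\lambda}$, the estimator is $$\widehat f_{\infty,n}(k)=\frac1{2\pi}\int_{-\pi}^{\pi}\frac{P_n^*(\lambda)}{p^*(\lambda)}e^{ik\lambda}\,d\lambda,\qquad k\in\mathbb{Z}$$ (well defined under $K_p<\infty$, since then $p^*\ne0$ a.e. and $|P_n^*|\le1$). $[f_0,f_1]=\{(1-w)f_0+wf_1:w\in[0,1]\}$. MISE means $\mathbb{E}_f\|\hat f-f\|_{\mathbb{H}}^2$. The MISE of $\widehat f_{\infty,n}$ having rate $n^{-1}$ over a class means its supremum over the class is $O(n^{-1})$;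 the rate is minimax over $\mathcal{C}$ if moreover $\liminf_n n\inf_{\hat f\in\mathcal{S}_n}\sup_{f\in\mathcal{C}}\mathbb{E}_f\|\hat f-f\|_{\mathbb{H}}^2>0$. "Universal" means not depending on $p,f_0,f_1,n$. *)

theory Defs
  imports "HOL-Probability.Probability"
begin

text \<open>The real Hilbert space \<open>\<ell>\<^sup>2(\<int>)\<close>, carried by functions on \<^typ>\<open>int\<close>. The squared norm takes
  values in \<^typ>\<open>ennreal\<close>, so that a function that is not square-summable has squared norm \<open>\<infinity>\<close>.\<close>

definition l2_sqnorm :: "(int \<Rightarrow> real) \<Rightarrow> ennreal" where
  "l2_sqnorm h = (\<integral>\<^sup>+k. ennreal ((h k)\<^sup>2) \<partial>count_space UNIV)"

definition l2 :: "(int \<Rightarrow> real) set" where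
  "l2 = {h. l2_sqnorm h < \<infinity>}"

definition l2_open :: "(int \<Rightarrow> real) set \<Rightarrow> bool" where
  "l2_open U \<longleftrightarrow> U \<subseteq> l2 \<and>
     (\<forall>g\<in>U. \<exists>r>0. \<forall>h\<in>l2. l2_sqnorm (\<lambda>k. h k - g k) < ennreal (r\<^sup>2) \<longrightarrow> h \<in> U)"

definition l2_borel :: "(int \<Rightarrow> real) measure" where
  "l2_borel = sigma l2 {U. l2_open U}"

text \<open>\<open>g\<^sup>*(t) = \<Sum>\<^sub>k g(k) e\<^bsup>-ikt\<^esup>\<close>; it is applied only to absolutely summable \<open>g\<close>.\<close>

definition fourier :: "(int \<Rightarrow> real) \<Rightarrow> real \<Rightarrow> complex" where
  "fourier g t = (\<Sum>\<^sub>\<infinity>k. of_real (g k) * exp (- (\<i> * of_int k * of_real t)))"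

text \<open>The division is that of \<^typ>\<open>ennreal\<close>, where \<open>1 / 0 = \<infinity>\<close>: zeros of \<open>p\<^sup>*\<close> contribute \<open>\<infinity>\<close>
  to the integrand.\<close>

definition deconv_const :: "int pmf \<Rightarrow> ennreal" where
  "deconv_const p = (\<integral>\<^sup>+t\<in>{-pi..pi}. (1 / ennreal ((cmod (fourier (pmf p) t))\<^sup>2)) \<partial>lborel)"

text \<open>Probability mass functions on \<open>\<int>\<close> are elements of \<^typ>\<open>int pmf\<close>. The law of one observation
  is the mixture under \<open>f\<close> of the translates \<open>k \<mapsto> p(k - \<theta>)\<close>.\<close>

definition obs_pmf :: "int pmf \<Rightarrow> int pmf \<Rightarrow> int pmf" where
  "obs_pmf p f = bind_pmf f (\<lambda>\<theta>. map_pmf (\<lambda>e. e + \<theta>) p)"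

lemma pmf_translate: "pmf (map_pmf (\<lambda>e. e + \<theta>) p) k = pmf p (k - \<theta>)" for k \<theta> :: int
  using pmf_map_inj'[of "\<lambda>e. e + \<theta>" p "k - \<theta>"] by (simp add: inj_def)

lemma pmf_obs_pmf: "pmf (obs_pmf p f) k = (\<Sum>\<^sub>\<infinity>\<theta>. pmf p (k - \<theta>) * pmf f \<theta>)"
proof -
  have "pmf (obs_pmf p f) k = measure_pmf.expectation f (\<lambda>\<theta>. pmf p (k - \<theta>))"
    by (simp add: obs_pmf_def pmf_bind pmf_translate)
  also have "\<dots> = infsetsum (\<lambda>\<theta>. pmf f \<theta> * pmf p (k - \<theta>)) UNIV"
    by (simp add: pmf_expectation_eq_infsetsum)
  also have "\<dots> = (\<Sum>\<^sub>\<infinity>\<theta>. pmf f \<theta> * pmf p (k - \<theta>))"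
  proof (rule infsetsum_infsum)
    show "Infinite_Set_Sum.abs_summable_on (\<lambda>\<theta>. pmf f \<theta> * pmf p (k - \<theta>)) UNIV"
      by (rule abs_summable_on_comparison_test'[OF pmf_abs_summable[of f]])
        (auto simp: pmf_le_1 mult_left_le)
  qed
  finally show ?thesis by (simp add: mult.commute)
qed

definition sample_space :: "nat \<Rightarrow> (nat \<Rightarrow> int) measure" where
  "sample_space n = (\<Pi>\<^sub>M j\<in>{..<n}. count_space UNIV)"

definition sample_law :: "int pmf \<Rightarrow> int pmf \<Rightarrow> nat \<Rightarrow> (nat \<Rightarrow> int) measure" where
  "sample_law p f n = (\<Pi>\<^sub>M j\<in>{..<n}. measure_pmf (obs_pmf p f))"

definition estimators :: "nat \<Rightarrow> ((nat \<Rightarrow> int) \<Rightarrow> int \<Rightarrow> real) set" where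
  "estimators n = sample_space n \<rightarrow>\<^sub>M l2_borel"

definition mise :: "int pmf \<Rightarrow> nat \<Rightarrow> ((nat \<Rightarrow> int) \<Rightarrow> int \<Rightarrow> real) \<Rightarrow> int pmf \<Rightarrow> ennreal" where
  "mise p n fhat f = (\<integral>\<^sup>+X. l2_sqnorm (\<lambda>k. fhat X k - pmf f k) \<partial>sample_law p f n)"

definition empirical_mass :: "nat \<Rightarrow> (nat \<Rightarrow> int) \<Rightarrow> int \<Rightarrow> real" where
  "empirical_mass n X k = real (card {j. j < n \<and> X j = k}) / real n"

definition deconv_integral :: "int pmf \<Rightarrow> nat \<Rightarrow> (nat \<Rightarrow> int) \<Rightarrow> int \<Rightarrow> complex" where
  "deconv_integral p n X k = 1 / (2 * of_real pi) *
     (LINT t:{-pi..pi}|lborel.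
        fourier (empirical_mass n X) t / fourier (pmf p) t * exp (\<i> * of_int k * of_real t))"

definition deconv_estimator :: "int pmf \<Rightarrow> nat \<Rightarrow> (nat \<Rightarrow> int) \<Rightarrow> int \<Rightarrow> real" where
  "deconv_estimator p n X k = Re (deconv_integral p n X k)"

lemma fourier_uminus: "fourier g (- t) = cnj (fourier g t)"
  unfolding fourier_def by (subst infsum_cnj[symmetric]) (simp add: exp_cnj)

text \<open>Taking real parts in \<^const>\<open>deconv_estimator\<close> only changes the type.\<close>

lemma of_real_deconv_estimator:
  "complex_of_real (deconv_estimator p n X k) = deconv_integral p n X k"
proof -
  define F where "F t = fourier (empirical_mass n X) t / fourier (pmf p) t
    * exp (\<i> * of_int k * of_real t)" for t :: real
  have F: "F (- t) = cnj (F t)" for t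
    by (simp add: F_def fourier_uminus exp_cnj)
  have "(LINT t:{-pi..pi}|lborel. F t) = (\<integral>t. indicator {-pi..pi} (- t) *\<^sub>R F (- t) \<partial>lborel)"
    unfolding set_lebesgue_integral_def
    by (subst lborel_integral_real_affine[where c = "-1" and t = 0]) simp_all
  also have "\<dots> = (\<integral>t. cnj (indicator {-pi..pi} t *\<^sub>R F t) \<partial>lborel)"
    by (intro Bochner_Integration.integral_cong) (auto simp: F indicator_def)
  also have "\<dots> = cnj (LINT t:{-pi..pi}|lborel. F t)"
    unfolding set_lebesgue_integral_def by (rule Bochner_Integration.integral_cnj)
  finally have "cnj (deconv_integral p n X k) = deconv_integral p n X k"
    unfolding deconv_integral_def F_def by simp
  then show ?thesis
    unfolding deconv_estimator_def by (metis Reals_cnj_iff of_real_Re)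
qed

definition pmf_segment :: "int pmf \<Rightarrow> int pmf \<Rightarrow> int pmf set" where
  "pmf_segment f0 f1 = {f. \<exists>w\<in>{0..1}. \<forall>k. pmf f k = (1 - w) * pmf f0 k + w * pmf f1 k}"

text \<open>Every weight is attained, i.e. convex combinations are again elements of \<^typ>\<open>int pmf\<close>.\<close>

lemma pmf_segment_weight:
  assumes "w \<in> {0..1}"
  shows "\<exists>f\<in>pmf_segment f0 f1. \<forall>k. pmf f k = (1 - w) * pmf f0 k + w * pmf f1 k"
proof -
  have "pmf (bind_pmf (bernoulli_pmf w) (\<lambda>b. if b then f1 else f0)) k
      = (1 - w) * pmf f0 k + w * pmf f1 k" for k
    using assms by (simp add: pmf_bind)
  then show ?thesis
    using assms unfolding pmf_segment_def by blast
qed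

definition sup_risk :: "int pmf \<Rightarrow> int pmf set \<Rightarrow> nat \<Rightarrow> ((nat \<Rightarrow> int) \<Rightarrow> int \<Rightarrow> real) \<Rightarrow> ennreal" where
  "sup_risk p C n fhat = (SUP f\<in>C. mise p n fhat f)"

definition minimax_risk :: "int pmf \<Rightarrow> int pmf set \<Rightarrow> nat \<Rightarrow> ennreal" where
  "minimax_risk p C n = (INF fhat\<in>estimators n. sup_risk p C n fhat)"

text \<open>\<open>O(n\<^sup>-\<^sup>1)\<close>, spelled out because the supremum of the risks is \<^typ>\<open>ennreal\<close>-valued.\<close>

definition parametric_rate :: "int pmf \<Rightarrow> int pmf set \<Rightarrow> bool" where
  "parametric_rate p C \<longleftrightarrow> (\<exists>A::real. \<forall>\<^sub>F n in sequentially.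
     sup_risk p C n (deconv_estimator p n) \<le> ennreal (A / real n))"

definition minimax_parametric_rate :: "int pmf \<Rightarrow> int pmf set \<Rightarrow> bool" where
  "minimax_parametric_rate p C \<longleftrightarrow>
     parametric_rate p C \<and> liminf (\<lambda>n. of_nat n * minimax_risk p C n) > 0"

definition segment_gap :: "int pmf \<Rightarrow> int pmf \<Rightarrow> real" where
  "segment_gap f0 f1 = (\<Sum>\<^sub>\<infinity>l. (pmf f1 l - pmf f0 l)\<^sup>2)"

definition obs_gap :: "int pmf \<Rightarrow> int pmf \<Rightarrow> int pmf \<Rightarrow> real" where
  "obs_gap p f0 f1 = (\<Sum>\<^sub>\<infinity>l. \<bar>pmf (obs_pmf p f1) l - pmf (obs_pmf p f0) l\<bar>)"

end

theory Submission imports Defs begin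

text \<open>Upper bound: the error \<open>fhat - f\<close> is the sequence of Fourier coefficients of
  \<open>(P\<^sub>n\<^sup>* - \<pi>\<^sub>f\<^sup>*) / p\<^sup>*\<close>, because \<open>\<pi>\<^sub>f\<^sup>* = p\<^sup>* f\<^sup>*\<close> and \<open>p\<^sup>* \<noteq> 0\<close> almost everywhere. Bessel's inequality
  bounds its squared norm by the integral of the squared modulus over \<open>2\<pi>\<close>, and the expectation of
  \<open>|P\<^sub>n\<^sup>* - \<pi>\<^sub>f\<^sup>*|\<^sup>2\<close> is a variance of a mean of \<open>n\<close> unimodular variables, hence at most \<open>1/n\<close>.

  Lower bound: compare the two mixtures with weights \<open>1/2 \<plusminus> \<delta>\<close>. Their observation densities
  \<open>P, Q\<close> have \<open>P - Q = 2\<delta>(\<pi>\<^sub>1 - \<pi>\<^sub>0)\<close> and \<open>P + Q = \<pi>\<^sub>0 + \<pi>\<^sub>1 \<ge> |\<pi>\<^sub>1 - \<pi>\<^sub>0|\<close>, so their Hellinger affinity is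
  at least \<open>1 - 2\<delta>\<^sup>2c\<^sub>1\<close>. Affinity is multiplicative over the sample; with
  \<open>\<delta>\<^sup>2 = 1/(4 + 4nc\<^sub>1)\<close> the affinity of the samples is at least \<open>1/2\<close>, and the two hypotheses are at
  squared distance \<open>4\<delta>\<^sup>2c\<^sub>0\<close>. This gives \<open>K\<^sub>1 = K\<^sub>2 = 16\<close>.\<close>

section \<open>Two-point lower bound\<close>

text \<open>A finite product of countable types is countable, so two measures on it agree once they
  agree on singletons, and a singleton is a box. Expectations over the sample thereby become
  weighted sums, for which every integrand is measurable.\<close>

lemma PiM_measure_pmf_eq_density:
  fixes q :: "'i \<Rightarrow> 'a::countable pmf"
  assumes "finite I"
  shows "PiM I (\<lambda>j. measure_pmf (q j)) =
    density (count_space (PiE I (\<lambda>_. UNIV))) (\<lambda>X. ennreal (\<Prod>j\<in>I. pmf (q j) (X j)))"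
    (is "?L = density (count_space ?\<Omega>) ?d")
proof (rule measure_eqI_countable)
  interpret product_sigma_finite "\<lambda>j. measure_pmf (q j)"
    by standard
  have count: "countable ?\<Omega>"
    using assms by (intro countable_PiE) auto
  have "sets ?L = sets (PiM I (\<lambda>_. count_space UNIV :: 'a measure))"
    by (intro sets_PiM_cong) auto
  also have "\<dots> = Pow ?\<Omega>"
    using assms by (subst count_space_PiM_finite) auto
  finally show "sets ?L = Pow ?\<Omega>" .
  show "sets (density (count_space ?\<Omega>) ?d) = Pow ?\<Omega>"
    by simp
  show "countable ?\<Omega>" by (rule count)
  fix X assume X: "X \<in> ?\<Omega>"
  then have "{X} = PiE I (\<lambda>j. {X j})"
    by (simp add: PiE_singleton PiE_iff)
  then have "emeasure ?L {X} = (\<Prod>j\<in>I. emeasure (measure_pmf (q j)) {X j})"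
    using assms by (simp add: emeasure_PiM)
  also have "\<dots> = ?d X"
    by (simp add: emeasure_pmf_single prod_ennreal)
  also have "\<dots> = emeasure (density (count_space ?\<Omega>) ?d) {X}"
    using X by (simp add: emeasure_density)
  finally show "emeasure ?L {X} = \<dots>" .
qed

lemma nn_integral_PiM_measure_pmf:
  fixes q :: "'i \<Rightarrow> 'a::countable pmf"
  assumes "finite I"
  shows "(\<integral>\<^sup>+X. g X \<partial>PiM I (\<lambda>j. measure_pmf (q j))) =
    (\<integral>\<^sup>+X. ennreal (\<Prod>j\<in>I. pmf (q j) (X j)) * g X \<partial>count_space (PiE I (\<lambda>_. UNIV)))"
  unfolding PiM_measure_pmf_eq_density[OF assms] by (simp add: nn_integral_density)

text \<open>The left-hand side is the minimum of the right-hand side over \<open>x\<close>.\<close>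

lemma weighted_square_sum_ge:
  fixes P Q x a b :: real
  assumes "P \<ge> 0" "Q \<ge> 0"
  shows "P * Q / (P + Q) * (a - b)\<^sup>2 \<le> P * (x - a)\<^sup>2 + Q * (x - b)\<^sup>2"
proof (cases "P + Q = 0")
  case False
  then have "P + Q > 0" using assms by linarith
  \<comment> \<open>Completing the square: the remainder vanishes exactly at the weighted mean of
    \<open>a\<close> and \<open>b\<close>.\<close>
  moreover have "(P * (x - a)\<^sup>2 + Q * (x - b)\<^sup>2) * (P + Q) - P * Q * (a - b)\<^sup>2
      = (P * (x - a) + Q * (x - b))\<^sup>2"
    by (simp add: power2_eq_square algebra_simps)
  then have "P * Q * (a - b)\<^sup>2 \<le> (P * (x - a)\<^sup>2 + Q * (x - b)\<^sup>2) * (P + Q)"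
    by (smt (verit) zero_le_power2)
  ultimately show ?thesis
    by (simp add: divide_simps)
qed (use assms in simp)

text \<open>The scalar inequality, summed over coordinates. Working in \<open>ennreal\<close> also
  covers a \<open>g\<close> at infinite distance from \<open>a\<close> or \<open>b\<close>.\<close>

lemma weighted_l2_sqnorm_sum_ge:
  assumes "P \<ge> 0" "Q \<ge> 0"
  shows "ennreal (P * Q / (P + Q)) * l2_sqnorm (\<lambda>k. a k - b k)
    \<le> ennreal P * l2_sqnorm (\<lambda>k. g k - a k) + ennreal Q * l2_sqnorm (\<lambda>k. g k - b k)"
  unfolding l2_sqnorm_def
  using assms weighted_square_sum_ge[OF assms]
  by (subst (1 2 3) nn_integral_cmult[symmetric], simp_all)
    (subst nn_integral_add[symmetric], auto intro!: nn_integral_mono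
      simp: ennreal_mult[symmetric] ennreal_plus[symmetric] simp del: ennreal_plus)

section \<open>Hellinger affinity and the two-point inequality\<close>

text \<open>Cauchy-Schwarz for the factorisation of \<open>sqrt (P x * Q x)\<close> through
  \<open>P x + Q x\<close>, whose integral is 2. The weight \<open>P * Q / (P + Q)\<close> is what
  the loss produces, but it does not factor over a sample; the affinity does.\<close>

lemma affinity_square_le:
  fixes P Q :: "'a \<Rightarrow> real"
  assumes [measurable]: "P \<in> borel_measurable M" "Q \<in> borel_measurable M"
    and nonneg: "\<And>x. P x \<ge> 0" "\<And>x. Q x \<ge> 0"
    and one: "(\<integral>\<^sup>+x. P x \<partial>M) = 1" "(\<integral>\<^sup>+x. Q x \<partial>M) = 1"
  shows "(\<integral>\<^sup>+x. sqrt (P x * Q x) \<partial>M)\<^sup>2 \<le> (\<integral>\<^sup>+x. P x * Q x / (P x + Q x) \<partial>M) * 2"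
proof -
  \<comment> \<open>If \<open>P x + Q x = 0\<close>, nonnegativity makes both densities vanish, so
    both sides are 0.\<close>
  have *: "sqrt (P x * Q x) = sqrt (P x * Q x / (P x + Q x)) * sqrt (P x + Q x)" for x
    using nonneg[of x] by (cases "P x + Q x = 0") (auto simp: real_sqrt_mult[symmetric] add_nonneg_eq_0_iff)
  have "(\<integral>\<^sup>+x. sqrt (P x * Q x) \<partial>M)\<^sup>2 =
      (\<integral>\<^sup>+x. ennreal (sqrt (P x * Q x / (P x + Q x))) * ennreal (sqrt (P x + Q x)) \<partial>M)\<^sup>2"
    using nonneg by (subst *) (simp add: ennreal_mult)
  also have "\<dots> \<le> (\<integral>\<^sup>+x. ennreal (sqrt (P x * Q x / (P x + Q x))) ^ 2 \<partial>M) *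
      (\<integral>\<^sup>+x. ennreal (sqrt (P x + Q x)) ^ 2 \<partial>M)"
    by (rule Cauchy_Schwarz_nn_integral) measurable
  also have "\<dots> = (\<integral>\<^sup>+x. P x * Q x / (P x + Q x) \<partial>M) * (\<integral>\<^sup>+x. ennreal (P x) + ennreal (Q x) \<partial>M)"
    using nonneg by (simp add: ennreal_power)
  also have "(\<integral>\<^sup>+x. ennreal (P x) + ennreal (Q x) \<partial>M) = 2"
    using one by (simp add: nn_integral_add)
  finally show ?thesis .
qed

text \<open>At each outcome the estimate \<open>g x\<close> cannot be close to both \<open>a\<close>
  and \<open>b\<close>; its weighted loss is at least the harmonic weight times their squared
  distance. Integrating leaves the quantity that the affinity bounds from below.\<close>

lemma le_cam_two_point:
  assumes nonneg: "\<And>x. P x \<ge> 0" "\<And>x. Q x \<ge> 0"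
    and one: "(\<integral>\<^sup>+x. ennreal (P x) \<partial>count_space \<Omega>) = 1" "(\<integral>\<^sup>+x. ennreal (Q x) \<partial>count_space \<Omega>) = 1"
  shows "(\<integral>\<^sup>+x. sqrt (P x * Q x) \<partial>count_space \<Omega>)\<^sup>2 * l2_sqnorm (\<lambda>k. a k - b k) \<le>
     2 * ((\<integral>\<^sup>+x. P x * l2_sqnorm (\<lambda>k. g x k - a k) \<partial>count_space \<Omega>)
       + (\<integral>\<^sup>+x. Q x * l2_sqnorm (\<lambda>k. g x k - b k) \<partial>count_space \<Omega>))"
proof -
  have "(\<integral>\<^sup>+x. sqrt (P x * Q x) \<partial>count_space \<Omega>)\<^sup>2 * l2_sqnorm (\<lambda>k. a k - b k)
    \<le> (\<integral>\<^sup>+x. P x * Q x / (P x + Q x) \<partial>count_space \<Omega>) * 2 * l2_sqnorm (\<lambda>k. a k - b k)"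
    using nonneg one by (intro mult_right_mono affinity_square_le) auto
  also have "\<dots> = 2 * (\<integral>\<^sup>+x. ennreal (P x * Q x / (P x + Q x)) * l2_sqnorm (\<lambda>k. a k - b k) \<partial>count_space \<Omega>)"
    by (subst nn_integral_multc) (simp_all add: mult_ac)
  also have "\<dots> \<le> 2 * (\<integral>\<^sup>+x. ennreal (P x) * l2_sqnorm (\<lambda>k. g x k - a k)
      + ennreal (Q x) * l2_sqnorm (\<lambda>k. g x k - b k) \<partial>count_space \<Omega>)"
    using nonneg by (intro mult_left_mono nn_integral_mono weighted_l2_sqnorm_sum_ge) auto
  finally show ?thesis
    by (simp add: nn_integral_add)
qed

lemma nn_integral_count_space_eq_infsum:
  fixes f :: "'a \<Rightarrow> real"
  assumes "f summable_on A" "\<And>x. x \<in> A \<Longrightarrow> f x \<ge> 0"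
  shows "(\<integral>\<^sup>+x. ennreal (f x) \<partial>count_space A) = ennreal (infsum f A)"
proof -
  have "Infinite_Set_Sum.abs_summable_on f A"
    unfolding abs_summable_equivalent[symmetric]
    using assms(1) summable_on_iff_abs_summable_on_real by blast
  then show ?thesis
    using assms by (simp add: nn_integral_conv_infsetsum infsetsum_infsum)
qed

lemma pmf_summable_on: "pmf p summable_on A"
  using pmf_abs_summable[of p A]
  unfolding abs_summable_equivalent[symmetric] by (rule abs_summable_summable)

text \<open>Counting measure on the finite product is the product of counting measures, so the
  integral factors. It serves twice: for the total mass of a product density and for the
  multiplicativity of the affinity.\<close>

lemma nn_integral_prod_count_space:
  fixes h :: "'a::countable \<Rightarrow> real"
  assumes "finite I" "\<And>k. h k \<ge> 0"
  shows "(\<integral>\<^sup>+X. ennreal (\<Prod>j\<in>I. h (X j)) \<partial>count_space (PiE I (\<lambda>_. UNIV))) =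
    (\<integral>\<^sup>+k. ennreal (h k) \<partial>count_space UNIV) ^ card I"
proof -
  interpret sigma_finite_measure "count_space (UNIV :: 'a set)"
    by (rule sigma_finite_measure_count_space)
  interpret product_sigma_finite "\<lambda>_. count_space (UNIV :: 'a set)"
    by standard
  show ?thesis
    using assms product_nn_integral_prod[of I "\<lambda>_ k. ennreal (h k)"]
    by (simp add: count_space_PiM_finite prod_ennreal)
qed

lemma mise_eq_sum:
  "mise p n g f = (\<integral>\<^sup>+X. ennreal (\<Prod>j<n. pmf (obs_pmf p f) (X j)) *
     l2_sqnorm (\<lambda>k. g X k - pmf f k) \<partial>count_space (PiE {..<n} (\<lambda>_. UNIV)))"
  unfolding mise_def sample_law_def by (simp add: nn_integral_PiM_measure_pmf)

lemma nn_integral_pmf_UNIV: "(\<integral>\<^sup>+k. ennreal (pmf p k) \<partial>count_space UNIV) = 1"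
  using nn_integral_pmf[where p = p and A = UNIV] by simp

lemma sqrt_prod: "sqrt (\<Prod>i\<in>I. f i) = (\<Prod>i\<in>I. sqrt (f i))"
  by (induction I rule: infinite_finite_induct) (simp_all add: real_sqrt_mult)

lemma two_point_mise:
  "((\<integral>\<^sup>+k. sqrt (pmf (obs_pmf p f) k * pmf (obs_pmf p h) k) \<partial>count_space UNIV) ^ n)\<^sup>2
     * l2_sqnorm (\<lambda>k. pmf f k - pmf h k) \<le> 2 * (mise p n g f + mise p n g h)"
proof -
  have one: "(\<integral>\<^sup>+X. ennreal (\<Prod>j<n. pmf q (X j)) \<partial>count_space (PiE {..<n} (\<lambda>_. UNIV))) = 1"
    for q :: "int pmf"
    by (subst nn_integral_prod_count_space) (auto simp: nn_integral_pmf_UNIV)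
  have "(\<integral>\<^sup>+X. sqrt ((\<Prod>j<n. pmf (obs_pmf p f) (X j)) * (\<Prod>j<n. pmf (obs_pmf p h) (X j)))
      \<partial>count_space (PiE {..<n} (\<lambda>_. UNIV)))
    = (\<integral>\<^sup>+k. sqrt (pmf (obs_pmf p f) k * pmf (obs_pmf p h) k) \<partial>count_space UNIV) ^ n"
    using nn_integral_prod_count_space[of "{..<n}" "\<lambda>k. sqrt (pmf (obs_pmf p f) k * pmf (obs_pmf p h) k)"]
    by (simp add: real_sqrt_mult prod.distrib sqrt_prod)
  then show ?thesis
    unfolding mise_eq_sum
    using le_cam_two_point[OF _ _ one[of "obs_pmf p f"] one[of "obs_pmf p h"],
        where g = g and a = "pmf f" and b = "pmf h"]
    by (simp add: prod_nonneg)
qed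

section \<open>Affinity of one observation under nearby mixtures\<close>

text \<open>\<open>D\<close> dominates the squared difference of the square roots of
  \<open>P\<close> and \<open>Q\<close>; integrating the expanded square bounds the affinity.
  Stating the condition on \<open>D\<close> as a product avoids a quotient at points where both
  densities vanish.\<close>

lemma affinity_ge:
  fixes P Q D :: "'a \<Rightarrow> real"
  assumes nonneg: "\<And>k. P k \<ge> 0" "\<And>k. Q k \<ge> 0" "\<And>k. D k \<ge> 0"
    and one: "(\<integral>\<^sup>+k. P k \<partial>count_space A) = 1" "(\<integral>\<^sup>+k. Q k \<partial>count_space A) = 1"
    and D: "\<And>k. (P k - Q k)\<^sup>2 \<le> D k * (P k + Q k)" "(\<integral>\<^sup>+k. D k \<partial>count_space A) \<le> ennreal (2 * d)"
    and d: "0 \<le> d"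
  shows "ennreal (1 - d) \<le> (\<integral>\<^sup>+k. sqrt (P k * Q k) \<partial>count_space A)"
proof -
  have pt: "P k + Q k \<le> 2 * sqrt (P k * Q k) + D k" for k
  proof (cases "P k + Q k = 0")
    case True
    then show ?thesis
      using nonneg[of k] by (smt (verit) real_sqrt_ge_zero zero_le_mult_iff)
  next
    case False
    then have pos: "P k + Q k > 0"
      using nonneg[of k] by linarith
    define u v where "u = sqrt (P k)" and "v = sqrt (Q k)"
    have uv: "u \<ge> 0" "v \<ge> 0" "P k = u\<^sup>2" "Q k = v\<^sup>2"
      using nonneg[of k] by (auto simp: u_def v_def)
    \<comment> \<open>The right side is the square of \<open>(u - v) * (u + v)\<close>, that is of
      \<open>P k - Q k\<close>; afterwards the positive factor \<open>u\<^sup>2 + v\<^sup>2\<close>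
      cancels against the bound with \<open>D k\<close>.\<close>
    have "(u - v)\<^sup>2 * (u\<^sup>2 + v\<^sup>2) \<le> (u - v)\<^sup>2 * (u + v)\<^sup>2"
      using uv by (intro mult_left_mono) (auto simp: power2_sum)
    also have "\<dots> = (P k - Q k)\<^sup>2"
      unfolding uv by (simp add: power2_eq_square algebra_simps)
    also have "\<dots> \<le> D k * (u\<^sup>2 + v\<^sup>2)"
      using D(1)[of k] uv by simp
    finally have "(u - v)\<^sup>2 \<le> D k"
      using pos uv by simp
    then show ?thesis
      by (simp add: uv real_sqrt_mult power2_diff)
  qed
  have "2 = (\<integral>\<^sup>+k. ennreal (P k) + ennreal (Q k) \<partial>count_space A)"
    using one by (simp add: nn_integral_add)
  also have "\<dots> \<le> (\<integral>\<^sup>+k. 2 * ennreal (sqrt (P k * Q k)) + ennreal (D k) \<partial>count_space A)"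
  proof (rule nn_integral_mono)
    fix k
    have "ennreal (P k) + ennreal (Q k) = ennreal (P k + Q k)"
      using nonneg by simp
    also have "\<dots> \<le> ennreal (2 * sqrt (P k * Q k) + D k)"
      by (rule ennreal_leI[OF pt])
    also have "\<dots> = 2 * ennreal (sqrt (P k * Q k)) + ennreal (D k)"
      using nonneg by (simp add: ennreal_mult)
    finally show "ennreal (P k) + ennreal (Q k) \<le> \<dots>" .
  qed
  also have "\<dots> = 2 * (\<integral>\<^sup>+k. sqrt (P k * Q k) \<partial>count_space A) + (\<integral>\<^sup>+k. D k \<partial>count_space A)"
    by (simp add: nn_integral_add nn_integral_cmult)
  also have "\<dots> \<le> 2 * (\<integral>\<^sup>+k. sqrt (P k * Q k) \<partial>count_space A) + ennreal (2 * d)"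
    using D(2) by (intro add_left_mono)
  finally have *: "2 \<le> 2 * (\<integral>\<^sup>+k. sqrt (P k * Q k) \<partial>count_space A) + ennreal (2 * d)" .
  show ?thesis
  \<comment> \<open>The subtraction is carried out in the reals; an infinite affinity satisfies the
    bound trivially.\<close>
  proof (cases "\<integral>\<^sup>+k. sqrt (P k * Q k) \<partial>count_space A" rule: ennreal_cases)
    case (real r)
    from * have "ennreal 2 \<le> ennreal (2 * r + 2 * d)"
      using real d by (simp add: ennreal_mult)
    then have "2 \<le> 2 * r + 2 * d"
      using real d by (subst (asm) ennreal_le_iff) auto
    then show ?thesis
      using real by (simp add: ennreal_leI)
  qed simp
qed

lemma obs_pmf_affine:
  assumes "\<And>k. pmf f k = (1 - w) * pmf f0 k + w * pmf f1 k"
  shows "pmf (obs_pmf p f) k = (1 - w) * pmf (obs_pmf p f0) k + w * pmf (obs_pmf p f1) k"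
proof -
  have summable: "(\<lambda>\<theta>. pmf p (k - \<theta>) * pmf h \<theta>) summable_on UNIV" for h
    by (rule summable_on_comparison_test[OF pmf_summable_on[of h]]) (auto simp: pmf_le_1 mult_left_le_one_le)
  have "(\<Sum>\<^sub>\<infinity>\<theta>. pmf p (k - \<theta>) * pmf f \<theta>) =
      (\<Sum>\<^sub>\<infinity>\<theta>. (1 - w) * (pmf p (k - \<theta>) * pmf f0 \<theta>) + w * (pmf p (k - \<theta>) * pmf f1 \<theta>))"
    by (intro infsum_cong) (simp add: assms algebra_simps)
  also have "\<dots> = (1 - w) * (\<Sum>\<^sub>\<infinity>\<theta>. pmf p (k - \<theta>) * pmf f0 \<theta>)
      + w * (\<Sum>\<^sub>\<infinity>\<theta>. pmf p (k - \<theta>) * pmf f1 \<theta>)"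
    by (subst infsum_add) (auto intro!: summable_on_cmult_right summable simp: infsum_cmult_right')
  finally show ?thesis
    unfolding pmf_obs_pmf .
qed

text \<open>A difference of two probabilities has modulus at most 1, so its square is at most its
  modulus, hence at most the sum of the two masses.\<close>

lemma summable_on_sq_diff_pmf: "(\<lambda>k. (pmf p k - pmf q k)\<^sup>2) summable_on A"
proof (rule summable_on_comparison_test[OF summable_on_add[OF pmf_summable_on[of p] pmf_summable_on[of q]]])
  fix k
  have "\<bar>pmf p k - pmf q k\<bar> \<le> 1" "\<bar>pmf p k - pmf q k\<bar> \<le> pmf p k + pmf q k"
    using pmf_le_1[of p k] pmf_le_1[of q k] pmf_nonneg[of p k] pmf_nonneg[of q k] by linarith+
  then have "\<bar>pmf p k - pmf q k\<bar> * \<bar>pmf p k - pmf q k\<bar> \<le> 1 * (pmf p k + pmf q k)"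
    by (intro mult_mono) auto
  then show "(pmf p k - pmf q k)\<^sup>2 \<le> pmf p k + pmf q k"
    by (simp add: power2_eq_square)
qed simp

text \<open>Centring the two weights at 1/2 keeps the sum of the observation densities independent
  of \<open>\<delta>\<close>, and that sum dominates \<open>\<bar>\<Delta> k\<bar>\<close>. The loss
  of affinity is therefore quadratic in \<open>\<delta>\<close> with the factor
  \<open>c1\<close>.\<close>

lemma minimax_risk_segment_ge:
  assumes "n > 0"
  shows "ennreal (segment_gap f0 f1 * inverse (16 + 16 * obs_gap p f0 f1 * real n))
     \<le> minimax_risk p (pmf_segment f0 f1) n"
proof -
  define c0 where "c0 = segment_gap f0 f1"
  define c1 where "c1 = obs_gap p f0 f1"
  \<comment> \<open>The term \<open>real n * c1\<close> bounds the total loss of affinity by 1/2;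
    the added 1 keeps \<open>\<delta>\<close> at most 1/2, so that both weights lie in the unit
    interval even when \<open>c1 = 0\<close>.\<close>
  define \<delta> where "\<delta> = 1 / (2 * sqrt (1 + real n * c1))"
  define \<Delta> where "\<Delta> k = pmf (obs_pmf p f1) k - pmf (obs_pmf p f0) k" for k
  have "(\<lambda>k. \<bar>\<Delta> k\<bar>) summable_on UNIV"
    by (rule summable_on_comparison_test[OF summable_on_add[OF pmf_summable_on[of "obs_pmf p f1"] pmf_summable_on[of "obs_pmf p f0"]]])
      (auto simp: \<Delta>_def abs_le_iff add_increasing add_increasing2)
  from nn_integral_count_space_eq_infsum[OF this]
  have c1: "(\<integral>\<^sup>+k. \<bar>\<Delta> k\<bar> \<partial>count_space UNIV) = ennreal c1"
    by (simp add: c1_def obs_gap_def \<Delta>_def)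
  have c1_nonneg: "c1 \<ge> 0"
    by (simp add: c1_def obs_gap_def infsum_nonneg)
  note nn_integral_count_space_eq_infsum[OF summable_on_sq_diff_pmf[of f1 f0]]
  then have c0: "(\<integral>\<^sup>+k. (pmf f1 k - pmf f0 k)\<^sup>2 \<partial>count_space UNIV) = ennreal c0"
    by (simp add: c0_def segment_gap_def)
  have c0_nonneg: "c0 \<ge> 0"
    by (simp add: c0_def segment_gap_def infsum_nonneg)
  have pos: "1 + real n * c1 > 0"
    using c1_nonneg by (simp add: add_pos_nonneg)
  have \<delta>: "\<delta> > 0" "\<delta>\<^sup>2 = 1 / (4 * (1 + real n * c1))"
    using pos by (auto simp: \<delta>_def power_divide power_mult_distrib)
  have "1 \<le> sqrt (1 + real n * c1)"
    using c1_nonneg by simp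
  then have "\<delta> \<le> 1 / 2"
    by (simp add: \<delta>_def field_simps)
  then have w: "1 / 2 + \<delta> \<in> {0..1}" "1 / 2 - \<delta> \<in> {0..1}"
    using \<delta>(1) by auto
  obtain f where f_in: "f \<in> pmf_segment f0 f1"
    and f: "\<And>k. pmf f k = (1 - (1 / 2 + \<delta>)) * pmf f0 k + (1 / 2 + \<delta>) * pmf f1 k"
    using pmf_segment_weight[OF w(1)] by metis
  obtain h where h_in: "h \<in> pmf_segment f0 f1"
    and h: "\<And>k. pmf h k = (1 - (1 / 2 - \<delta>)) * pmf f0 k + (1 / 2 - \<delta>) * pmf f1 k"
    using pmf_segment_weight[OF w(2)] by metis
  have fh_diff: "pmf f k - pmf h k = 2 * \<delta> * (pmf f1 k - pmf f0 k)" for k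
    unfolding f h by (simp add: algebra_simps)
  \<comment> \<open>The bound on the affinity loss per observation: half the sum of
    \<open>4 * \<delta>\<^sup>2 * \<bar>\<Delta> k\<bar>\<close> over \<open>k\<close>.\<close>
  define d where "d = 2 * \<delta>\<^sup>2 * c1"
  have d: "d \<ge> 0" "real n * d \<le> 1 / 2" "d \<le> 1"
  proof -
    show "d \<ge> 0"
      using c1_nonneg by (simp add: d_def)
    have "d = c1 / (2 * (1 + real n * c1))"
      using pos unfolding d_def \<delta> by (simp add: divide_simps)
    then have "real n * d = real n * c1 / (2 * (1 + real n * c1))"
      by simp
    also have "\<dots> \<le> 1 / 2"
      using pos by (simp add: divide_simps)
    finally show nd: "real n * d \<le> 1 / 2" .
    have "1 * d \<le> real n * d"
      using \<open>d \<ge> 0\<close> \<open>n > 0\<close> by (intro mult_right_mono) auto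
    then show "d \<le> 1"
      using nd by linarith
  qed
  have aff: "ennreal (1 - d) \<le> (\<integral>\<^sup>+k. sqrt (pmf (obs_pmf p f) k * pmf (obs_pmf p h) k) \<partial>count_space UNIV)"
  proof (rule affinity_ge[where D = "\<lambda>k. 4 * \<delta>\<^sup>2 * \<bar>\<Delta> k\<bar>"])
    fix k
    have PQ: "pmf (obs_pmf p f) k - pmf (obs_pmf p h) k = 2 * \<delta> * \<Delta> k"
      "pmf (obs_pmf p f) k + pmf (obs_pmf p h) k = pmf (obs_pmf p f1) k + pmf (obs_pmf p f0) k"
      unfolding obs_pmf_affine[OF f] obs_pmf_affine[OF h] \<Delta>_def by (simp_all add: algebra_simps)
    have "(2 * \<delta> * \<Delta> k)\<^sup>2 = 4 * \<delta>\<^sup>2 * \<bar>\<Delta> k\<bar> * \<bar>\<Delta> k\<bar>"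
      by (simp add: power_mult_distrib) (simp add: power2_eq_square)
    also have "\<dots> \<le> 4 * \<delta>\<^sup>2 * \<bar>\<Delta> k\<bar> * (pmf (obs_pmf p f1) k + pmf (obs_pmf p f0) k)"
      by (intro mult_left_mono) (auto simp: \<Delta>_def abs_le_iff add_increasing add_increasing2)
    finally show "(pmf (obs_pmf p f) k - pmf (obs_pmf p h) k)\<^sup>2
        \<le> 4 * \<delta>\<^sup>2 * \<bar>\<Delta> k\<bar> * (pmf (obs_pmf p f) k + pmf (obs_pmf p h) k)"
      unfolding PQ .
  next
    have "(\<integral>\<^sup>+k. ennreal (4 * \<delta>\<^sup>2 * \<bar>\<Delta> k\<bar>) \<partial>count_space UNIV) = ennreal (4 * \<delta>\<^sup>2) * ennreal c1"
      by (subst c1[symmetric], subst nn_integral_cmult[symmetric]) (auto simp: ennreal_mult)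
    also have "\<dots> = ennreal (2 * d)"
      using c1_nonneg by (simp add: ennreal_mult[symmetric] d_def mult.assoc)
    finally show "(\<integral>\<^sup>+k. ennreal (4 * \<delta>\<^sup>2 * \<bar>\<Delta> k\<bar>) \<partial>count_space UNIV) \<le> ennreal (2 * d)"
      by simp
  qed (auto simp: d nn_integral_pmf_UNIV)
  \<comment> \<open>Bernoulli's inequality gives \<open>1 - real n * d\<close>, which is at least
    1/2; it requires \<open>d \<le> 1\<close>.\<close>
  have "1 / 2 \<le> (1 - d) ^ n"
    using Bernoulli_inequality[of "- d" n] d by simp
  then have "ennreal (1 / 2) \<le> ennreal (1 - d) ^ n"
    using d by (simp add: ennreal_power del: ennreal_half)
  also have "\<dots> \<le> (\<integral>\<^sup>+k. sqrt (pmf (obs_pmf p f) k * pmf (obs_pmf p h) k) \<partial>count_space UNIV) ^ n"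
    using aff by (rule power_mono) simp
  finally have half: "ennreal (1 / 2) \<le> \<dots>" .
  have dist: "l2_sqnorm (\<lambda>k. pmf f k - pmf h k) = ennreal (4 * \<delta>\<^sup>2 * c0)"
    unfolding l2_sqnorm_def fh_diff
    by (simp add: ennreal_mult c0_nonneg c0[symmetric] power_mult_distrib nn_integral_cmult)
  have "ennreal (c0 * inverse (16 + 16 * c1 * real n)) \<le> sup_risk p (pmf_segment f0 f1) n g" for g
  proof -
    \<comment> \<open>The squared sample affinity contributes at least 1/4, and the squared
      separation is \<open>4 * \<delta>\<^sup>2 * c0\<close>.\<close>
    have "\<delta>\<^sup>2 * c0 = (1 / 2)\<^sup>2 * (4 * \<delta>\<^sup>2 * c0)"
      by (simp add: power2_eq_square)
    then have "ennreal (\<delta>\<^sup>2 * c0) = (ennreal (1 / 2))\<^sup>2 * ennreal (4 * \<delta>\<^sup>2 * c0)"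
      using c0_nonneg by (simp only: ennreal_mult ennreal_power zero_le_power2 mult_nonneg_nonneg)
    also have "\<dots> \<le> ((\<integral>\<^sup>+k. sqrt (pmf (obs_pmf p f) k * pmf (obs_pmf p h) k) \<partial>count_space UNIV) ^ n)\<^sup>2
        * l2_sqnorm (\<lambda>k. pmf f k - pmf h k)"
      unfolding dist by (intro mult_right_mono power_mono half) auto
    also have "\<dots> \<le> 2 * (mise p n g f + mise p n g h)"
      by (rule two_point_mise)
    also have "\<dots> \<le> 2 * (sup_risk p (pmf_segment f0 f1) n g + sup_risk p (pmf_segment f0 f1) n g)"
      unfolding sup_risk_def by (intro mult_left_mono add_mono SUP_upper f_in h_in) auto
    also have "\<dots> = 4 * sup_risk p (pmf_segment f0 f1) n g"
      by (simp add: mult_2[symmetric] mult.assoc[symmetric])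
    finally have *: "ennreal (\<delta>\<^sup>2 * c0) \<le> 4 * sup_risk p (pmf_segment f0 f1) n g" .
    \<comment> \<open>Origin of 16: a factor 4 from the two-point inequality and a factor 4 from the
      denominator of \<open>\<delta>\<^sup>2\<close>.\<close>
    have eq: "c0 * inverse (16 + 16 * c1 * real n) = \<delta>\<^sup>2 * c0 / 4"
      using pos by (simp add: \<delta> field_simps)
    show ?thesis
    proof (cases "sup_risk p (pmf_segment f0 f1) n g" rule: ennreal_cases)
      case (real r)
      with * have "ennreal (\<delta>\<^sup>2 * c0) \<le> ennreal (4 * r)"
        by (simp add: ennreal_mult)
      then have "\<delta>\<^sup>2 * c0 \<le> 4 * r"
        using real by (subst (asm) ennreal_le_iff) auto
      then show ?thesis
        using real unfolding eq by (simp add: ennreal_leI)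
    qed simp
  qed
  then show ?thesis
    unfolding minimax_risk_def c0_def c1_def by (intro INF_greatest)
qed

section \<open>Fourier coefficients and Bessel's inequality\<close>

text \<open>One period as a finite measure in its own right, which turns set integrals into plain
  ones. The duplicated endpoint is a null set.\<close>

definition torus :: "real measure" where
  "torus = restrict_space lborel {-pi..pi}"

lemma space_torus [simp]: "space torus = {-pi..pi}"
  by (simp add: torus_def space_restrict_space)

lemma measurable_torus: "f \<in> borel_measurable borel \<Longrightarrow> f \<in> borel_measurable torus"
  unfolding torus_def by (rule measurable_restrict_space1) simp

lemma emeasure_torus: "emeasure torus (space torus) = ennreal (2 * pi)"
  by (simp add: torus_def emeasure_restrict_space)

lemma measure_torus: "measure torus (space torus) = 2 * pi"
  unfolding measure_def emeasure_torus by simp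

lemma finite_measure_torus: "finite_measure torus"
  by (rule finite_measureI) (simp add: emeasure_torus del: space_torus)

interpretation torus: finite_measure torus
  by (rule finite_measure_torus)

lemma nn_integral_torus: "(\<integral>\<^sup>+t\<in>{-pi..pi}. f t \<partial>lborel) = (\<integral>\<^sup>+t. f t \<partial>torus)"
  by (simp add: torus_def nn_integral_restrict_space)

lemma LINT_torus:
  fixes f :: "real \<Rightarrow> complex"
  shows "(LINT t:{-pi..pi}|lborel. f t) = (\<integral>t. f t \<partial>torus)"
  by (simp add: torus_def integral_restrict_space set_lebesgue_integral_def)

text \<open>The characters of the circle, with positive exponent; the summands of
  \<open>fourier\<close> thus carry \<open>expi (- k)\<close>.\<close>

definition expi :: "int \<Rightarrow> real \<Rightarrow> complex" where
  "expi k t = exp (\<i> * of_int k * of_real t)"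

lemma expi_measurable [measurable]: "expi k \<in> borel_measurable torus"
  unfolding expi_def by (intro measurable_torus borel_measurable_continuous_onI continuous_intros)

lemma norm_expi [simp]: "cmod (expi k t) = 1"
proof -
  have "expi k t = cis (of_int k * t)"
    by (simp add: expi_def cis_conv_exp mult.assoc)
  then show ?thesis by simp
qed

lemma expi_mult: "expi k t * expi l t = expi (k + l) t"
  by (simp add: expi_def exp_add[symmetric] algebra_simps)

lemma cnj_expi: "cnj (expi k t) = expi (- k) t"
  by (simp add: expi_def exp_cnj)

lemma expi_0 [simp]: "expi 0 t = 1"
  by (simp add: expi_def)

lemma integrable_expi [simp]: "integrable torus (expi k)"
  by (rule torus.integrable_const_bound[where B = 1]) auto

text \<open>Orthogonality of the characters: for \<open>k \<noteq> 0\<close> the antiderivative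
  \<open>expi k t / (\<i> * k)\<close> is periodic, so its endpoint values cancel.\<close>

lemma integral_expi: "(\<integral>t. expi k t \<partial>torus) = (if k = 0 then 2 * pi else 0)"
proof (cases "k = 0")
  case True
  then show ?thesis
    by (simp add: measure_torus scaleR_conv_of_real del: space_torus)
next
  case False
  have "((\<lambda>t. expi k t) has_integral expi k pi / (\<i> * k) - expi k (- pi) / (\<i> * k)) {-pi..pi}"
  proof (rule fundamental_theorem_of_calculus)
    fix t :: real
    have "((\<lambda>z. exp (\<i> * k * z) / (\<i> * k)) has_field_derivative exp (\<i> * k * of_real t)) (at (of_real t))"
      using False by (auto intro!: derivative_eq_intros)
    then show "((\<lambda>t. expi k t / (\<i> * k)) has_vector_derivative expi k t) (at t within {-pi..pi})"
      unfolding expi_def by (rule has_vector_derivative_real_field)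
  qed simp
  moreover have "expi k pi = expi k (- pi)"
  proof -
    have "expi k pi = expi k (- pi) * exp (2 * of_int k * of_real pi * \<i>)"
      unfolding expi_def exp_add[symmetric] by (simp add: algebra_simps)
    also have "exp (2 * of_int k * of_real pi * \<i>) = 1"
      by (subst exp_eq_1) (auto intro!: exI[of _ k])
    finally show ?thesis by simp
  qed
  \<comment> \<open>The fundamental theorem yields a gauge integral; integrability identifies it
    with the Lebesgue integral.\<close>
  moreover have "set_integrable lborel {-pi..pi} (expi k)"
    using integrable_expi[of k] unfolding torus_def set_integrable_def
    by (subst (asm) integrable_restrict_space) auto
  then have "(LINT t:{-pi..pi}|lborel. expi k t) = integral {-pi..pi} (expi k)"
    by (rule set_borel_integral_eq_integral)
  ultimately have "(LINT t:{-pi..pi}|lborel. expi k t) = 0"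
    by (metis diff_self integral_unique)
  then show ?thesis
    using False by (simp add: LINT_torus)
qed

section \<open>Fourier coefficients and Bessel's inequality\<close>

text \<open>The sign makes this the inversion formula for \<open>fourier\<close>: it is the
  classical Fourier coefficient of \<open>G\<close> at \<open>- k\<close>.\<close>

definition fcoeff :: "(real \<Rightarrow> complex) \<Rightarrow> int \<Rightarrow> complex" where
  "fcoeff G k = 1 / (2 * pi) * (\<integral>t. G t * expi k t \<partial>torus)"

lemma integrable_mult_expi:
  assumes "integrable torus G"
  shows "integrable torus (\<lambda>t. G t * expi k t)"
  by (rule Bochner_Integration.integrable_bound[OF assms])
     (use assms in \<open>auto simp: norm_mult\<close>)

text \<open>On a finite measure square integrability implies integrability, since
  \<open>x \<le> 1 + x\<^sup>2\<close>.\<close>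

lemma square_integrable_torus:
  fixes G :: "real \<Rightarrow> complex"
  assumes [measurable]: "G \<in> borel_measurable torus"
    and fin: "(\<integral>\<^sup>+t. ennreal ((cmod (G t))\<^sup>2) \<partial>torus) < \<infinity>"
  shows "integrable torus (\<lambda>t. (cmod (G t))\<^sup>2)" "integrable torus G"
proof -
  show sq: "integrable torus (\<lambda>t. (cmod (G t))\<^sup>2)"
    using fin by (intro integrableI_bounded) auto
  show "integrable torus G"
  proof (rule Bochner_Integration.integrable_bound)
    show "integrable torus (\<lambda>t. 1 + (cmod (G t))\<^sup>2)"
      using sq by simp
    have "x \<le> 1 + x\<^sup>2" for x :: real
      using sum_squares_bound[of x 1] by (simp add: power2_eq_square) (smt (verit) zero_le_square)
    then show "AE t in torus. cmod (G t) \<le> norm (1 + (cmod (G t))\<^sup>2)"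
      by auto
  qed simp
qed

text \<open>\<open>G'\<close> is the residual after projecting onto the line of
  \<open>expi (- k)\<close>. Pythagoras gives the drop in squared norm, and orthogonality leaves the
  other coefficients unchanged.\<close>

lemma fcoeff_remove:
  fixes G :: "real \<Rightarrow> complex" and k :: int
  assumes G: "integrable torus G" "integrable torus (\<lambda>t. (cmod (G t))\<^sup>2)"
    and G'_def: "G' = (\<lambda>t. G t - fcoeff G k * expi (- k) t)"
  shows "integrable torus G'" "integrable torus (\<lambda>t. (cmod (G' t))\<^sup>2)"
    "(\<integral>t. (cmod (G' t))\<^sup>2 \<partial>torus) = (\<integral>t. (cmod (G t))\<^sup>2 \<partial>torus) - 2 * pi * (cmod (fcoeff G k))\<^sup>2"
    "j \<noteq> k \<Longrightarrow> fcoeff G' j = fcoeff G j"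
proof -
  define a where "a = fcoeff G k"
  have coeff: "(\<integral>t. G t * expi k t \<partial>torus) = 2 * pi * a"
    by (simp add: a_def fcoeff_def)
  have sq: "(cmod (G' t))\<^sup>2 = (cmod (G t))\<^sup>2 - 2 * Re (cnj a * (G t * expi k t)) + (cmod a)\<^sup>2" for t
  proof -
    have "(cmod (x - y))\<^sup>2 = (cmod x)\<^sup>2 - 2 * Re (x * cnj y) + (cmod y)\<^sup>2" for x y
      by (simp add: cmod_power2 power2_diff algebra_simps)
    from this[of "G t" "a * expi (- k) t"] show ?thesis
      by (simp add: G'_def a_def norm_mult cnj_expi mult_ac)
  qed
  note int = integrable_mult_expi[OF G(1), of k]
  have int': "integrable torus (\<lambda>t. Re (cnj a * (G t * expi k t)))"
    using int by (intro integrable_Re integrable_mult_right)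
  show "integrable torus G'"
    using G by (simp add: G'_def)
  show "integrable torus (\<lambda>t. (cmod (G' t))\<^sup>2)"
    unfolding sq using G int' by (intro Bochner_Integration.integrable_add Bochner_Integration.integrable_diff integrable_mult_right) auto
  \<comment> \<open>The cross term enters twice with a minus sign and the square of the projection
    once with a plus sign, so one multiple of \<open>2 * pi * (cmod a)\<^sup>2\<close> is
    lost.\<close>
  have "(\<integral>t. Re (cnj a * (G t * expi k t)) \<partial>torus) = Re (cnj a * (2 * pi * a))"
    using int by (subst integral_Re) (simp_all add: coeff)
  also have "\<dots> = 2 * pi * (cmod a)\<^sup>2"
    unfolding cmod_power2 by (simp add: power2_eq_square algebra_simps)
  finally have cross: "(\<integral>t. Re (cnj a * (G t * expi k t)) \<partial>torus) = 2 * pi * (cmod a)\<^sup>2" .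
  define R where "R t = Re (cnj a * (G t * expi k t))" for t
  have "(\<integral>t. (cmod (G' t))\<^sup>2 \<partial>torus) = (\<integral>t. (cmod (G t))\<^sup>2 \<partial>torus)
      - 2 * (\<integral>t. R t \<partial>torus) + 2 * pi * (cmod a)\<^sup>2"
    using G int'[folded R_def]
    unfolding sq R_def[symmetric] by (simp add: measure_torus del: space_torus)
  then show "(\<integral>t. (cmod (G' t))\<^sup>2 \<partial>torus) = (\<integral>t. (cmod (G t))\<^sup>2 \<partial>torus) - 2 * pi * (cmod (fcoeff G k))\<^sup>2"
    unfolding R_def cross by (simp add: a_def)
  assume "j \<noteq> k"
  have "(\<integral>t. G' t * expi j t \<partial>torus) = (\<integral>t. G t * expi j t - a * expi (j - k) t \<partial>torus)"
    by (simp add: G'_def a_def left_diff_distrib mult.assoc expi_mult)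
  also have "\<dots> = (\<integral>t. G t * expi j t \<partial>torus) - a * (\<integral>t. expi (j - k) t \<partial>torus)"
    using integrable_mult_expi[OF G(1)] by simp
  also have "\<dots> = (\<integral>t. G t * expi j t \<partial>torus)"
    using \<open>j \<noteq> k\<close> by (simp add: integral_expi)
  finally show "fcoeff G' j = fcoeff G j"
    by (simp add: fcoeff_def)
qed

text \<open>Coefficients are split off one at a time. The induction hypothesis is applied to the
  residual, so \<open>G\<close> must stay arbitrary.\<close>

lemma bessel_finite:
  assumes "finite K" "integrable torus G" "integrable torus (\<lambda>t. (cmod (G t))\<^sup>2)"
  shows "2 * pi * (\<Sum>k\<in>K. (cmod (fcoeff G k))\<^sup>2) \<le> (\<integral>t. (cmod (G t))\<^sup>2 \<partial>torus)"
  using assms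
proof (induction K arbitrary: G)
  case empty
  then show ?case by (simp add: integral_nonneg_AE)
next
  case (insert k K)
  define G' where "G' = (\<lambda>t. G t - fcoeff G k * expi (- k) t)"
  note G' = fcoeff_remove[OF insert.prems G'_def]
  have "fcoeff G' j = fcoeff G j" if "j \<in> K" for j
  proof (rule G'(4))
    show "j \<noteq> k"
      using that insert.hyps by blast
  qed
  then have "(\<Sum>j\<in>K. (cmod (fcoeff G' j))\<^sup>2) = (\<Sum>j\<in>K. (cmod (fcoeff G j))\<^sup>2)"
    by simp
  then show ?case
    using insert.IH[OF G'(1,2)] insert.hyps unfolding G'(3) by (simp add: distrib_left)
qed

text \<open>Finite partial sums are bounded uniformly, hence so is the full sum. If the squared norm
  of \<open>G\<close> is infinite, so is the right side.\<close>

lemma bessel: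
  fixes G :: "real \<Rightarrow> complex"
  assumes [measurable]: "G \<in> borel_measurable torus"
  shows "(\<integral>\<^sup>+k. ennreal ((cmod (fcoeff G k))\<^sup>2) \<partial>count_space UNIV)
    \<le> ennreal (1 / (2 * pi)) * (\<integral>\<^sup>+t. ennreal ((cmod (G t))\<^sup>2) \<partial>torus)"
proof (cases "(\<integral>\<^sup>+t. ennreal ((cmod (G t))\<^sup>2) \<partial>torus) < \<infinity>")
  case True
  note int = square_integrable_torus[OF assms True]
  define S where "S = (\<integral>t. (cmod (G t))\<^sup>2 \<partial>torus)"
  have fin: "(\<Sum>k\<in>K. 2 * pi * (cmod (fcoeff G k))\<^sup>2) \<le> S" if "finite K" for K
    using bessel_finite[OF that int(2,1)] by (simp add: S_def sum_distrib_left)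
  then have summable: "(\<lambda>k. 2 * pi * (cmod (fcoeff G k))\<^sup>2) summable_on UNIV"
    by (intro nonneg_bdd_above_summable_on bdd_aboveI[of _ S]) auto
  then have "(\<Sum>\<^sub>\<infinity>k. 2 * pi * (cmod (fcoeff G k))\<^sup>2) \<le> S"
    using fin by (intro infsum_le_finite_sums)
  then have "(\<integral>\<^sup>+k. ennreal (2 * pi * (cmod (fcoeff G k))\<^sup>2) \<partial>count_space UNIV) \<le> ennreal S"
    by (subst nn_integral_count_space_eq_infsum[OF summable]) (auto intro: ennreal_leI)
  also have "ennreal S = (\<integral>\<^sup>+t. ennreal ((cmod (G t))\<^sup>2) \<partial>torus)"
    unfolding S_def using int(1) by (subst nn_integral_eq_integral) auto
  finally have "ennreal (2 * pi) * (\<integral>\<^sup>+k. ennreal ((cmod (fcoeff G k))\<^sup>2) \<partial>count_space UNIV)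
      \<le> (\<integral>\<^sup>+t. ennreal ((cmod (G t))\<^sup>2) \<partial>torus)"
    by (simp only: ennreal_mult' nn_integral_cmult)
       (simp add: ennreal_mult nn_integral_cmult)
  then have "ennreal (1 / (2 * pi)) * (ennreal (2 * pi) * (\<integral>\<^sup>+k. ennreal ((cmod (fcoeff G k))\<^sup>2) \<partial>count_space UNIV))
      \<le> ennreal (1 / (2 * pi)) * (\<integral>\<^sup>+t. ennreal ((cmod (G t))\<^sup>2) \<partial>torus)"
    by (rule mult_left_mono) simp
  moreover have "ennreal (1 / (2 * pi)) * ennreal (2 * pi) = 1"
    by (subst ennreal_mult[symmetric]) auto
  ultimately show ?thesis
    by (simp add: mult.assoc[symmetric])
qed (simp add: not_less top_unique ennreal_mult_top)

section \<open>Fourier transforms of probability mass functions\<close>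

lemma integral_bind_pmf_real:
  fixes f :: "'a \<Rightarrow> real"
  assumes "\<And>x. \<bar>f x\<bar> \<le> B"
  shows "measure_pmf.expectation (bind_pmf M N) f = measure_pmf.expectation M (\<lambda>x. measure_pmf.expectation (N x) f)"
  unfolding measure_pmf_bind
proof (rule integral_bind[where K = "count_space UNIV" and B = B and B' = 1])
  show "(\<lambda>x. measure_pmf (N x)) \<in> measurable (measure_pmf M) (subprob_algebra (count_space UNIV))"
    using measurable_measure_pmf[of N] by (simp cong: measurable_cong_sets)
qed (auto simp: assms measure_pmf.finite_measure_axioms measure_pmf.emeasure_space_1[simplified])

text \<open>Real and imaginary parts inherit the bound on the modulus, so the real case applies to
  each.\<close>

lemma integral_bind_pmf_complex:
  fixes f :: "'a \<Rightarrow> complex"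
  assumes bound: "\<And>x. cmod (f x) \<le> B"
  shows "measure_pmf.expectation (bind_pmf M N) f = measure_pmf.expectation M (\<lambda>x. measure_pmf.expectation (N x) f)"
proof -
  have int: "integrable (measure_pmf q) f" for q
    by (rule measure_pmf.integrable_const_bound[where B = B]) (auto simp: bound)
  have int2: "integrable (measure_pmf M) (\<lambda>x. measure_pmf.expectation (N x) f)"
  proof (rule measure_pmf.integrable_const_bound[where B = B])
    have "cmod (measure_pmf.expectation (N x) f) \<le> B" for x
    proof -
      have "cmod (measure_pmf.expectation (N x) f) \<le> measure_pmf.expectation (N x) (\<lambda>x. cmod (f x))"
        by (rule integral_norm_bound)
      also have "\<dots> \<le> B"
        using int bound by (intro measure_pmf.integral_le_const) auto
      finally show ?thesis .
    qed
    then show "AE x in measure_pmf M. cmod (measure_pmf.expectation (N x) f) \<le> B"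
      by simp
  qed simp
  show ?thesis
  proof (rule complex_eqI)
    show "Re (measure_pmf.expectation (bind_pmf M N) f) = Re (measure_pmf.expectation M (\<lambda>x. measure_pmf.expectation (N x) f))"
      using int int2 integral_bind_pmf_real[of "\<lambda>x. Re (f x)" B M N] order_trans[OF abs_Re_le_cmod bound]
      by (simp flip: integral_Re)
    show "Im (measure_pmf.expectation (bind_pmf M N) f) = Im (measure_pmf.expectation M (\<lambda>x. measure_pmf.expectation (N x) f))"
      using int int2 integral_bind_pmf_real[of "\<lambda>x. Im (f x)" B M N] order_trans[OF abs_Im_le_cmod bound]
      by (simp flip: integral_Im)
  qed
qed

lemma expectation_pmf_complex:
  fixes g :: "'a \<Rightarrow> complex"
  assumes bound: "\<And>x. cmod (g x) \<le> B"
  shows "measure_pmf.expectation p g = (\<Sum>\<^sub>\<infinity>x. of_real (pmf p x) * g x)"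
proof -
  have "measure_pmf.expectation p g = infsetsum (\<lambda>x. of_real (pmf p x) * g x) UNIV"
    unfolding infsetsum_def measure_pmf_eq_density
    by (subst integral_density) (simp_all add: scaleR_conv_of_real)
  also have "\<dots> = (\<Sum>\<^sub>\<infinity>x. of_real (pmf p x) * g x)"
  proof (rule infsetsum_infsum)
    have "Infinite_Set_Sum.abs_summable_on (\<lambda>x. pmf p x * B) UNIV"
      by (intro abs_summable_on_cmult_left pmf_abs_summable)
    then show "Infinite_Set_Sum.abs_summable_on (\<lambda>x. of_real (pmf p x) * g x) UNIV"
      by (rule abs_summable_on_comparison_test) (auto simp: norm_mult abs_mult intro!: mult_left_mono order_trans[OF bound abs_ge_self])
  qed
  finally show ?thesis .
qed

text \<open>Read as a characteristic function, the transform becomes accessible to norm bounds for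
  integrals and to Fubini.\<close>

lemma fourier_pmf: "fourier (pmf p) t = measure_pmf.expectation p (\<lambda>k. expi (- k) t)"
  by (subst expectation_pmf_complex[where B = 1]) (simp_all add: fourier_def expi_def)

lemma integrable_pmf_expi: "integrable (measure_pmf p) (\<lambda>k. expi (l k) t)"
  by (rule measure_pmf.integrable_const_bound[where B = 1]) auto

lemma cmod_fourier_pmf_le: "cmod (fourier (pmf p) t) \<le> 1"
proof -
  have "cmod (fourier (pmf p) t) \<le> measure_pmf.expectation p (\<lambda>k. cmod (expi (- k) t))"
    unfolding fourier_pmf by (rule integral_norm_bound)
  then show ?thesis by simp
qed

text \<open>The integer coordinate is countable, so measurability of each section suffices; the
  coordinates are swapped to use this.\<close>

lemma case_prod_expi_measurable:
  fixes p :: "int pmf"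
  shows "(\<lambda>(t, k). expi (f k) t) \<in> borel_measurable (torus \<Otimes>\<^sub>M measure_pmf p)"
proof -
  have "(\<lambda>(k, t). expi (f k) t) \<in> borel_measurable (count_space UNIV \<Otimes>\<^sub>M torus)"
    by (rule measurable_pair_measure_countable1) auto
  then have "(\<lambda>x. (\<lambda>(k, t). expi (f k) t) (snd x, fst x)) \<in> borel_measurable (torus \<Otimes>\<^sub>M measure_pmf p)"
    by (rule measurable_compose[rotated]) (auto intro!: measurable_Pair measurable_compose[OF measurable_snd])
  then show ?thesis
    by (simp add: case_prod_beta)
qed

lemma fourier_pmf_measurable [measurable]: "fourier (pmf p) \<in> borel_measurable torus"
proof -
  have "(\<lambda>t. measure_pmf.expectation p (\<lambda>k. expi (- k) t)) \<in> borel_measurable torus"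
    using case_prod_expi_measurable by (rule measure_pmf.borel_measurable_lebesgue_integral)
  then show ?thesis
    by (simp add: fourier_pmf[abs_def])
qed

text \<open>The convolution theorem: an observation is a draw from \<open>f\<close> plus independent
  noise from \<open>p\<close>, and characters turn the sum into a product.\<close>

lemma fourier_obs_pmf: "fourier (pmf (obs_pmf p f)) t = fourier (pmf p) t * fourier (pmf f) t"
proof -
  have "fourier (pmf (obs_pmf p f)) t
      = measure_pmf.expectation f (\<lambda>\<theta>. measure_pmf.expectation (map_pmf (\<lambda>e. e + \<theta>) p) (\<lambda>k. expi (- k) t))"
    unfolding fourier_pmf obs_pmf_def by (rule integral_bind_pmf_complex[where B = 1]) simp
  also have "\<dots> = measure_pmf.expectation f (\<lambda>\<theta>. measure_pmf.expectation p (\<lambda>e. expi (- e) t * expi (- \<theta>) t))"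
    by (simp add: expi_mult)
  also have "\<dots> = fourier (pmf p) t * fourier (pmf f) t"
    by (simp add: fourier_pmf)
  finally show ?thesis .
qed

text \<open>Fourier inversion: after Fubini, orthogonality kills every \<open>\<theta>\<close>
  except \<open>k\<close>.\<close>

lemma fcoeff_fourier_pmf: "fcoeff (fourier (pmf f)) k = pmf f k"
proof -
  interpret P: pair_sigma_finite torus "measure_pmf f"
    by standard
  interpret F: finite_measure "torus \<Otimes>\<^sub>M measure_pmf f"
    by (intro finite_measure_pair_measure finite_measure_torus measure_pmf.finite_measure_axioms)
  have int: "integrable (torus \<Otimes>\<^sub>M measure_pmf f) (\<lambda>(t, \<theta>). expi (k - \<theta>) t)"
    by (rule F.integrable_const_bound[where B = 1]) (auto intro!: case_prod_expi_measurable)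
  have "(\<integral>t. fourier (pmf f) t * expi k t \<partial>torus)
      = (\<integral>t. measure_pmf.expectation f (\<lambda>\<theta>. expi (- \<theta>) t * expi k t) \<partial>torus)"
    by (simp add: fourier_pmf)
  also have "\<dots> = (\<integral>t. measure_pmf.expectation f (\<lambda>\<theta>. expi (k - \<theta>) t) \<partial>torus)"
    by (simp add: expi_mult)
  also have "\<dots> = measure_pmf.expectation f (\<lambda>\<theta>. \<integral>t. expi (k - \<theta>) t \<partial>torus)"
    using P.Fubini_integral[OF int] by simp
  also have "\<dots> = measure_pmf.expectation f (\<lambda>\<theta>. complex_of_real (2 * pi * indicator {k} \<theta>))"
    by (intro Bochner_Integration.integral_cong) (auto simp: integral_expi indicator_def)
  also have "\<dots> = 2 * pi * pmf f k"
    by (subst integral_complex_of_real) (simp add: pmf.rep_eq)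
  finally show ?thesis
    by (simp add: fcoeff_def)
qed

section \<open>Transform of the empirical measure\<close>

text \<open>The series has finite support, the set of observed values; grouping the sample by value
  gives a mean of \<open>n\<close> unimodular terms.\<close>

lemma fourier_empirical_mass:
  "fourier (empirical_mass n X) t = (\<Sum>j<n. expi (- X j) t) / n"
  unfolding fourier_def
proof (rule infsumI, rule has_sum_finite_neutralI)
  show "finite (X ` {..<n})" by simp
  have "(\<Sum>j<n. expi (- X j) t) = (\<Sum>k\<in>X ` {..<n}. \<Sum>j\<in>{j\<in>{..<n}. X j = k}. expi (- X j) t)"
    by (rule sum.group[symmetric]) auto
  also have "\<dots> = (\<Sum>k\<in>X ` {..<n}. of_nat (card {j. j < n \<and> X j = k}) * expi (- k) t)"
    by (intro sum.cong) auto
  finally show "(\<Sum>j<n. expi (- X j) t) / n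
    = (\<Sum>k\<in>X ` {..<n}. of_real (empirical_mass n X k) * exp (- (\<i> * of_int k * of_real t)))"
    by (simp add: empirical_mass_def expi_def sum_divide_distrib)
  fix k assume "k \<in> UNIV - X ` {..<n}"
  then have "{j. j < n \<and> X j = k} = {}"
    by auto
  then show "of_real (empirical_mass n X k) * exp (- (\<i> * of_int k * of_real t)) = 0"
    by (simp add: empirical_mass_def)
qed simp

lemma fourier_empirical_measurable [measurable]: "fourier (empirical_mass n X) \<in> borel_measurable torus"
  unfolding fourier_empirical_mass[abs_def] by measurable

lemma cmod_fourier_empirical_le: "cmod (fourier (empirical_mass n X) t) \<le> 1"
proof -
  have "cmod (\<Sum>j<n. expi (- X j) t) \<le> n"
    using norm_sum[of "\<lambda>j. expi (- X j) t" "{..<n}"] by simp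
  \<comment> \<open>For \<open>n = 0\<close>, division by zero makes the transform 0.\<close>
  then show ?thesis
    by (cases "n = 0") (simp_all add: fourier_empirical_mass norm_divide)
qed

section \<open>Risk of the deconvolution estimator\<close>

text \<open>Independence makes the expectation a product, one factor of which is the vanishing mean
  of \<open>f\<close>.\<close>

lemma integral_PiM_pair:
  fixes f g :: "'a::countable \<Rightarrow> complex" and q :: "'a pmf"
  assumes "finite I" "i \<in> I" "j \<in> I" "i \<noteq> j" "integrable (measure_pmf q) f" "integrable (measure_pmf q) g"
    and zero: "measure_pmf.expectation q f = 0"
  shows "(\<integral>X. f (X i) * g (X j) \<partial>PiM I (\<lambda>_. measure_pmf q)) = 0"
proof -
  interpret product_sigma_finite "\<lambda>_. measure_pmf q"
    by standard
  \<comment> \<open>Padding with the constant 1 turns a product of two coordinates into a product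
    over all of \<open>I\<close>.\<close>
  define F where "F l = (if l = i then f else if l = j then g else (\<lambda>_. 1))" for l
  have "(\<Prod>l\<in>I. F l (X l)) = f (X i) * g (X j)" for X
  proof -
    have "(\<Prod>l\<in>I. F l (X l)) = (\<Prod>l\<in>I. (if l = i then f (X l) else 1) * (if l = j then g (X l) else 1))"
      using assms by (intro prod.cong) (auto simp: F_def)
    also have "\<dots> = f (X i) * g (X j)"
      using assms by (simp add: prod.distrib)
    finally show ?thesis .
  qed
  then have "(\<integral>X. f (X i) * g (X j) \<partial>PiM I (\<lambda>_. measure_pmf q)) = (\<Prod>l\<in>I. measure_pmf.expectation q (F l))"
    using product_integral_prod[of I F] assms by (simp add: F_def)
  also have "\<dots> = 0"
    using assms by (intro prod_zero) (auto simp: F_def intro!: bexI[of _ i])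
  finally show ?thesis .
qed

lemma integral_PiM_component:
  fixes f :: "'a \<Rightarrow> complex" and q :: "'a pmf"
  assumes "i \<in> I"
  shows "(\<integral>X. f (X i) \<partial>PiM I (\<lambda>_. measure_pmf q)) = measure_pmf.expectation q f"
proof -
  interpret product_prob_space "\<lambda>_. measure_pmf q" I
    by standard
  have "measure_pmf.expectation q f = integral\<^sup>L (distr (PiM I (\<lambda>_. measure_pmf q)) (measure_pmf q) (\<lambda>X. X i)) f"
    using assms by (simp add: PiM_component)
  also have "\<dots> = (\<integral>X. f (X i) \<partial>PiM I (\<lambda>_. measure_pmf q))"
    using assms by (intro integral_distr) auto
  finally show ?thesis ..
qed

text \<open>Additivity of variance: in the expanded square the off-diagonal terms vanish by
  independence and centring.\<close>

lemma second_moment_sum: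
  fixes Y :: "'a::countable \<Rightarrow> complex" and q :: "'a pmf"
  assumes I: "finite I" and bound: "\<And>x. cmod (Y x) \<le> B"
    and zero: "measure_pmf.expectation q Y = 0"
  shows "(\<integral>\<^sup>+X. ennreal ((cmod (\<Sum>j\<in>I. Y (X j)))\<^sup>2) \<partial>PiM I (\<lambda>_. measure_pmf q))
    = ennreal (real (card I) * measure_pmf.expectation q (\<lambda>x. (cmod (Y x))\<^sup>2))"
proof -
  let ?M = "PiM I (\<lambda>_. measure_pmf q)"
  interpret P: prob_space ?M
    by (intro prob_space_PiM) (rule prob_space_measure_pmf)
  have B: "0 \<le> B"
    using bound[of undefined] norm_ge_zero[of "Y undefined"] by linarith
  have comp [measurable]: "(\<lambda>X. Y (X j)) \<in> borel_measurable ?M" if "j \<in> I" for j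
    using that by (intro measurable_compose[OF measurable_component_singleton]) auto
  have intY: "integrable (measure_pmf q) Y"
    by (rule measure_pmf.integrable_const_bound[where B = B]) (auto simp: bound)
  have int: "integrable ?M (\<lambda>X. Y (X i) * cnj (Y (X j)))" if "i \<in> I" "j \<in> I" for i j
  proof (rule P.integrable_const_bound[where B = "B * B"])
    show "AE X in ?M. cmod (Y (X i) * cnj (Y (X j))) \<le> B * B"
      using bound B by (auto simp: norm_mult intro!: mult_mono)
  qed (use that in measurable)
  \<comment> \<open>The computation runs over the complex numbers, where the squared modulus is a
    product with the conjugate.\<close>
  have sq: "complex_of_real ((cmod (\<Sum>j\<in>I. Y (X j)))\<^sup>2) = (\<Sum>i\<in>I. \<Sum>j\<in>I. Y (X i) * cnj (Y (X j)))" for X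
    unfolding complex_norm_square by (simp add: sum_product)
  have "integrable ?M (\<lambda>X. complex_of_real ((cmod (\<Sum>j\<in>I. Y (X j)))\<^sup>2))"
    unfolding sq using int by (intro Bochner_Integration.integrable_sum) auto
  then have int_sq: "integrable ?M (\<lambda>X. (cmod (\<Sum>j\<in>I. Y (X j)))\<^sup>2)"
    by (simp only: complex_of_real_integrable_eq)
  have "complex_of_real (\<integral>X. (cmod (\<Sum>j\<in>I. Y (X j)))\<^sup>2 \<partial>?M)
      = (\<integral>X. complex_of_real ((cmod (\<Sum>j\<in>I. Y (X j)))\<^sup>2) \<partial>?M)"
    by (simp only: integral_complex_of_real)
  also have "\<dots> = (\<Sum>i\<in>I. \<Sum>j\<in>I. \<integral>X. Y (X i) * cnj (Y (X j)) \<partial>?M)"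
    unfolding sq using int by (simp add: Bochner_Integration.integral_sum)
  also have "\<dots> = (\<Sum>i\<in>I. \<Sum>j\<in>I. if i = j then complex_of_real (measure_pmf.expectation q (\<lambda>x. (cmod (Y x))\<^sup>2)) else 0)"
  proof (intro sum.cong refl)
    fix i j assume ij: "i \<in> I" "j \<in> I"
    show "(\<integral>X. Y (X i) * cnj (Y (X j)) \<partial>?M)
      = (if i = j then complex_of_real (measure_pmf.expectation q (\<lambda>x. (cmod (Y x))\<^sup>2)) else 0)"
    proof (cases "i = j")
      case True
      then show ?thesis
        using integral_PiM_component[of i I q "\<lambda>x. Y x * cnj (Y x)"] ij
        by (simp add: complex_norm_square[symmetric] del: of_real_power)
    next
      case False
      then show ?thesis
        using integral_PiM_pair[OF I ij False intY, of "\<lambda>x. cnj (Y x)"] intY zero by simp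
    qed
  qed
  also have "\<dots> = complex_of_real (real (card I) * measure_pmf.expectation q (\<lambda>x. (cmod (Y x))\<^sup>2))"
    using I by simp
  finally have "(\<integral>X. (cmod (\<Sum>j\<in>I. Y (X j)))\<^sup>2 \<partial>?M) = real (card I) * measure_pmf.expectation q (\<lambda>x. (cmod (Y x))\<^sup>2)"
    by (simp only: of_real_eq_iff)
  then show ?thesis
    using int_sq by (subst nn_integral_eq_integral) auto
qed

lemma deconv_integral_eq_fcoeff:
  "deconv_integral p n X k = fcoeff (\<lambda>t. fourier (empirical_mass n X) t / fourier (pmf p) t) k"
  by (simp add: deconv_integral_def fcoeff_def LINT_torus expi_def)

lemma variance_empirical_mass:
  assumes "n > 0"
  shows "(\<integral>\<^sup>+X. ennreal ((cmod (fourier (empirical_mass n X) t - fourier (pmf q) t))\<^sup>2)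
    \<partial>PiM {..<n} (\<lambda>_. measure_pmf q)) \<le> ennreal (1 / n)"
proof -
  define Y where "Y k = (expi (- k) t - fourier (pmf q) t) / n" for k
  have dev: "fourier (empirical_mass n X) t - fourier (pmf q) t = (\<Sum>j<n. Y (X j))" for X
    using assms by (simp add: Y_def fourier_empirical_mass sum_subtractf diff_divide_distrib sum_divide_distrib)
  have "measure_pmf.expectation q (\<lambda>k. expi (- k) t - fourier (pmf q) t) = 0"
    by (simp add: integrable_pmf_expi fourier_pmf)
  then have zero: "measure_pmf.expectation q Y = 0"
    by (simp add: Y_def[abs_def])
  have bound: "cmod (Y k) \<le> 2 / n" for k
    using norm_triangle_ineq4[of "expi (- k) t" "fourier (pmf q) t"] cmod_fourier_pmf_le[of q t]
    by (simp add: Y_def norm_divide divide_right_mono)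
  define \<phi> where "\<phi> = fourier (pmf q) t"
  have sq: "(cmod (Y k))\<^sup>2 = (1 - 2 * Re (cnj \<phi> * expi (- k) t) + (cmod \<phi>)\<^sup>2) / n\<^sup>2" for k
  proof -
    have "(cmod (x - y))\<^sup>2 = (cmod x)\<^sup>2 - 2 * Re (cnj y * x) + (cmod y)\<^sup>2" for x y
      unfolding cmod_power2 by (simp add: power2_eq_square algebra_simps)
    from this[of "expi (- k) t" \<phi>] show ?thesis
      by (simp add: Y_def \<phi>_def norm_divide power_divide)
  qed
  define R where "R k = Re (cnj \<phi> * expi (- k) t)" for k
  have int: "integrable (measure_pmf q) R"
    unfolding R_def by (intro integrable_Re integrable_mult_right integrable_pmf_expi)
  have "measure_pmf.expectation q R = Re (cnj \<phi> * \<phi>)"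
    unfolding R_def by (subst integral_Re) (auto intro!: integrable_pmf_expi simp: \<phi>_def fourier_pmf)
  also have "\<dots> = (cmod \<phi>)\<^sup>2"
    unfolding cmod_power2 by (simp add: power2_eq_square)
  finally have ER: "measure_pmf.expectation q R = (cmod \<phi>)\<^sup>2" .
  \<comment> \<open>The variance of a unimodular variable is 1 minus the squared modulus of its
    mean; discarding the latter gives a bound uniform in \<open>t\<close>.\<close>
  have "measure_pmf.expectation q (\<lambda>k. (cmod (Y k))\<^sup>2) = (1 - (cmod \<phi>)\<^sup>2) / n\<^sup>2"
    using int unfolding sq R_def[symmetric] by (simp add: ER)
  also have "\<dots> \<le> 1 / n\<^sup>2"
    by (intro divide_right_mono) auto
  finally have "real n * measure_pmf.expectation q (\<lambda>k. (cmod (Y k))\<^sup>2) \<le> real n * (1 / n\<^sup>2)"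
    by (intro mult_left_mono) auto
  also have "\<dots> = 1 / n"
    using assms by (simp add: power2_eq_square)
  finally show ?thesis
    unfolding dev by (subst second_moment_sum[OF _ bound zero]) (auto intro!: ennreal_leI)
qed

section \<open>Division by the noise transform\<close>

lemma deconv_const_eq: "deconv_const p = (\<integral>\<^sup>+t. 1 / ennreal ((cmod (fourier (pmf p) t))\<^sup>2) \<partial>torus)"
  by (simp add: deconv_const_def nn_integral_torus)

text \<open>A zero of the transform makes the integrand infinite, which a finite integral permits
  only on a null set.\<close>

lemma AE_fourier_nonzero:
  assumes "deconv_const p < \<infinity>"
  shows "AE t in torus. fourier (pmf p) t \<noteq> 0"
proof -
  have "AE t in torus. 1 / ennreal ((cmod (fourier (pmf p) t))\<^sup>2) \<noteq> \<infinity>"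
    using assms by (intro nn_integral_PInf_AE) (auto simp: deconv_const_eq)
  then show ?thesis
    by eventually_elim auto
qed

text \<open>At \<open>z = 0\<close> the two conventions clash: the complex quotient is 0, while the
  \<open>ennreal\<close> reciprocal is infinite. The identity is therefore applied almost everywhere
  only.\<close>

lemma ennreal_cmod_divide:
  assumes "z \<noteq> 0"
  shows "ennreal ((cmod (w / z))\<^sup>2) = ennreal ((cmod w)\<^sup>2) * (1 / ennreal ((cmod z)\<^sup>2))"
proof -
  have "1 / ennreal ((cmod z)\<^sup>2) = ennreal (1 / (cmod z)\<^sup>2)"
    using assms divide_ennreal[of 1 "(cmod z)\<^sup>2"] by simp
  then show ?thesis
    by (simp add: ennreal_mult[symmetric] norm_divide power_divide)
qed

text \<open>The empirical transform has modulus at most 1, so \<open>deconv_const p\<close>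
  dominates. The Bochner integral in the estimator is thus a genuine one.\<close>

lemma nn_integral_quotient_finite:
  assumes K: "deconv_const p < \<infinity>"
  shows "(\<integral>\<^sup>+t. ennreal ((cmod (fourier (empirical_mass n X) t / fourier (pmf p) t))\<^sup>2) \<partial>torus) < \<infinity>"
proof -
  have "(\<integral>\<^sup>+t. ennreal ((cmod (fourier (empirical_mass n X) t / fourier (pmf p) t))\<^sup>2) \<partial>torus) \<le> deconv_const p"
    unfolding deconv_const_eq
  proof (rule nn_integral_mono_AE)
    show "AE t in torus. ennreal ((cmod (fourier (empirical_mass n X) t / fourier (pmf p) t))\<^sup>2)
        \<le> 1 / ennreal ((cmod (fourier (pmf p) t))\<^sup>2)"
      using AE_fourier_nonzero[OF K]
    proof eventually_elim
      case (elim t)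
      have "ennreal ((cmod (fourier (empirical_mass n X) t))\<^sup>2) \<le> 1"
        using cmod_fourier_empirical_le[of n X t] by (simp add: power_le_one)
      then show ?case
        unfolding ennreal_cmod_divide[OF elim]
        using mult_right_mono[of "ennreal ((cmod (fourier (empirical_mass n X) t))\<^sup>2)" 1
            "1 / ennreal ((cmod (fourier (pmf p) t))\<^sup>2)"] by simp
    qed
  qed
  then show ?thesis
    using K by (rule le_less_trans)
qed

lemma deconv_estimator_sq: "(deconv_estimator p n X k)\<^sup>2 = (cmod (deconv_integral p n X k))\<^sup>2"
  by (simp flip: of_real_deconv_estimator)

lemma deconv_estimator_in_l2:
  assumes "deconv_const p < \<infinity>"
  shows "deconv_estimator p n X \<in> l2"
proof -
  have "l2_sqnorm (deconv_estimator p n X) \<le> ennreal (1 / (2 * pi)) *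
      (\<integral>\<^sup>+t. ennreal ((cmod (fourier (empirical_mass n X) t / fourier (pmf p) t))\<^sup>2) \<partial>torus)"
    unfolding l2_sqnorm_def deconv_estimator_sq deconv_integral_eq_fcoeff by (rule bessel) measurable
  also have "\<dots> < \<infinity>"
    using nn_integral_quotient_finite[OF assms] by (simp add: ennreal_mult_less_top)
  finally show ?thesis
    by (simp add: l2_def)
qed

lemma sample_space_eq: "sample_space n = count_space (PiE {..<n} (\<lambda>_. UNIV))"
  unfolding sample_space_def by (simp add: count_space_PiM_finite)

text \<open>The sample space is discrete, so measurability reduces to taking values in
  \<open>l2\<close>, which Bessel's inequality supplies.\<close>

lemma deconv_estimator_in_estimators:
  assumes "deconv_const p < \<infinity>"
  shows "deconv_estimator p n \<in> estimators n"
proof -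
  have "space l2_borel = l2"
    unfolding l2_borel_def by (rule space_measure_of) (auto simp: l2_open_def)
  then show ?thesis
    using deconv_estimator_in_l2[OF assms] by (simp add: estimators_def sample_space_eq)
qed

lemma l2_sqnorm_deconv_error_le:
  assumes K: "deconv_const p < \<infinity>"
  shows "l2_sqnorm (\<lambda>k. deconv_estimator p n X k - pmf f k) \<le> ennreal (1 / (2 * pi)) *
    (\<integral>\<^sup>+t. ennreal ((cmod (fourier (empirical_mass n X) t - fourier (pmf (obs_pmf p f)) t))\<^sup>2)
      * (1 / ennreal ((cmod (fourier (pmf p) t))\<^sup>2)) \<partial>torus)"
proof -
  define G where "G t = fourier (empirical_mass n X) t / fourier (pmf p) t" for t
  define D where "D t = G t - fourier (pmf f) t" for t
  have [measurable]: "G \<in> borel_measurable torus" "D \<in> borel_measurable torus"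
    unfolding G_def[abs_def] D_def[abs_def] by measurable
  have intG: "integrable torus G"
    using nn_integral_quotient_finite[OF K] by (intro square_integrable_torus) (auto simp: G_def)
  have intf: "integrable torus (fourier (pmf f))"
    by (rule torus.integrable_const_bound[where B = 1]) (auto simp: cmod_fourier_pmf_le)
  \<comment> \<open>Linearity rests on integrability of both terms, since a non-integrable function
    would have Bochner integral 0.\<close>
  have "fcoeff D k = fcoeff G k - fcoeff (fourier (pmf f)) k" for k
    using integrable_mult_expi[OF intG, of k] integrable_mult_expi[OF intf, of k]
    by (simp add: fcoeff_def D_def left_diff_distrib right_diff_distrib diff_divide_distrib)
  then have "complex_of_real (deconv_estimator p n X k - pmf f k) = fcoeff D k" for k
    by (simp add: of_real_deconv_estimator deconv_integral_eq_fcoeff fcoeff_fourier_pmf G_def[abs_def])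
  then have "(deconv_estimator p n X k - pmf f k)\<^sup>2 = (cmod (fcoeff D k))\<^sup>2" for k
    by (metis norm_of_real power2_abs)
  then have "l2_sqnorm (\<lambda>k. deconv_estimator p n X k - pmf f k)
      \<le> ennreal (1 / (2 * pi)) * (\<integral>\<^sup>+t. ennreal ((cmod (D t))\<^sup>2) \<partial>torus)"
    unfolding l2_sqnorm_def by (simp add: bessel)
  also have "(\<integral>\<^sup>+t. ennreal ((cmod (D t))\<^sup>2) \<partial>torus) = (\<integral>\<^sup>+t.
      ennreal ((cmod (fourier (empirical_mass n X) t - fourier (pmf (obs_pmf p f)) t))\<^sup>2)
      * (1 / ennreal ((cmod (fourier (pmf p) t))\<^sup>2)) \<partial>torus)"
  proof (rule nn_integral_cong_AE)
    show "AE t in torus. ennreal ((cmod (D t))\<^sup>2) =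
      ennreal ((cmod (fourier (empirical_mass n X) t - fourier (pmf (obs_pmf p f)) t))\<^sup>2)
      * (1 / ennreal ((cmod (fourier (pmf p) t))\<^sup>2))"
      using AE_fourier_nonzero[OF K]
    proof eventually_elim
      case (elim t)
      then have "D t = (fourier (empirical_mass n X) t - fourier (pmf (obs_pmf p f)) t) / fourier (pmf p) t"
        by (simp add: D_def G_def fourier_obs_pmf diff_divide_distrib)
      then show ?case
        by (simp only: ennreal_cmod_divide[OF elim])
    qed
  qed
  finally show ?thesis .
qed

text \<open>Tonelli moves the expectation inside the frequency integral; the variance bound
  \<open>1 / n\<close> holds at every frequency, and what remains integrates to
  \<open>deconv_const p\<close>.\<close>

lemma mise_deconv_le:
  assumes K: "deconv_const p < \<infinity>" and n: "n > 0"
  shows "mise p n (deconv_estimator p n) f \<le> deconv_const p / ennreal (2 * pi * real n)"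
proof -
  let ?\<Omega> = "PiE {..<n} (\<lambda>_. UNIV :: int set)"
  define q where "q = obs_pmf p f"
  define W where "W X = ennreal (\<Prod>j<n. pmf q (X j))" for X :: "nat \<Rightarrow> int"
  define V where "V X t = ennreal ((cmod (fourier (empirical_mass n X) t - fourier (pmf q) t))\<^sup>2)" for X t
  define r where "r t = 1 / ennreal ((cmod (fourier (pmf p) t))\<^sup>2)" for t
  have [measurable]: "V X \<in> borel_measurable torus" "r \<in> borel_measurable torus" for X
    unfolding V_def[abs_def] r_def[abs_def] by measurable
  have count: "countable ?\<Omega>"
    by (intro countable_PiE) auto
  have "mise p n (deconv_estimator p n) f
      \<le> (\<integral>\<^sup>+X. W X * (ennreal (1 / (2 * pi)) * (\<integral>\<^sup>+t. V X t * r t \<partial>torus)) \<partial>count_space ?\<Omega>)"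
    unfolding mise_eq_sum W_def V_def r_def q_def
    by (intro nn_integral_mono mult_left_mono l2_sqnorm_deconv_error_le K) auto
  also have "\<dots> = ennreal (1 / (2 * pi)) * (\<integral>\<^sup>+X. \<integral>\<^sup>+t. W X * V X t * r t \<partial>torus \<partial>count_space ?\<Omega>)"
    by (simp add: nn_integral_cmult[symmetric] mult_ac)
  also have "(\<integral>\<^sup>+X. \<integral>\<^sup>+t. W X * V X t * r t \<partial>torus \<partial>count_space ?\<Omega>)
      = (\<integral>\<^sup>+t. \<integral>\<^sup>+X. W X * V X t * r t \<partial>count_space ?\<Omega> \<partial>torus)"
    by (rule nn_integral_count_space_nn_integral[OF count, symmetric]) measurable
  also have "\<dots> = (\<integral>\<^sup>+t. (\<integral>\<^sup>+X. W X * V X t \<partial>count_space ?\<Omega>) * r t \<partial>torus)"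
    by (simp add: nn_integral_multc)
  also have "\<dots> \<le> (\<integral>\<^sup>+t. ennreal (1 / n) * r t \<partial>torus)"
  proof (intro nn_integral_mono mult_right_mono)
    fix t
    show "(\<integral>\<^sup>+X. W X * V X t \<partial>count_space ?\<Omega>) \<le> ennreal (1 / n)"
      using variance_empirical_mass[OF n, where t = t and q = q]
      by (simp add: nn_integral_PiM_measure_pmf W_def V_def)
  qed simp
  also have "\<dots> = ennreal (1 / n) * deconv_const p"
    by (simp add: nn_integral_cmult deconv_const_eq r_def)
  finally have "mise p n (deconv_estimator p n) f \<le> ennreal (1 / (2 * pi)) * (ennreal (1 / n) * deconv_const p)"
    by (simp add: mult_left_mono)
  also have "\<dots> = ennreal (1 / (2 * pi * n)) * deconv_const p"
    by (simp add: ennreal_mult[symmetric] mult.assoc[symmetric])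
  also have "\<dots> = deconv_const p / ennreal (2 * pi * n)"
    using n by (simp add: divide_ennreal_def inverse_ennreal mult.commute inverse_eq_divide)
  finally show ?thesis .
qed

section \<open>Rates\<close>

lemma sup_risk_deconv_le:
  assumes "deconv_const p < \<infinity>" "n > 0"
  shows "sup_risk p C n (deconv_estimator p n) \<le> deconv_const p / ennreal (2 * pi * real n)"
  unfolding sup_risk_def using mise_deconv_le[OF assms] by (intro SUP_least)

lemma minimax_risk_mono: "C \<subseteq> D \<Longrightarrow> minimax_risk p C n \<le> minimax_risk p D n"
  unfolding minimax_risk_def sup_risk_def by (intro INF_mono' SUP_subset_mono) auto

text \<open>The deconvolution estimator is one competitor in the infimum, and enlarging the class
  can only raise its supremum risk.\<close>

lemma minimax_risk_le_deconv:
  assumes "deconv_const p < \<infinity>"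
  shows "minimax_risk p C n \<le> sup_risk p UNIV n (deconv_estimator p n)"
  unfolding minimax_risk_def
  by (rule INF_lower2[OF deconv_estimator_in_estimators[OF assms]])
     (auto simp: sup_risk_def intro: SUP_subset_mono)

lemma parametric_rate_deconv:
  assumes "deconv_const p < \<infinity>"
  shows "parametric_rate p C"
proof -
  obtain K where K: "deconv_const p = ennreal K" "K \<ge> 0"
    using assms by (cases "deconv_const p" rule: ennreal_cases) auto
  have "\<forall>\<^sub>F n in sequentially. sup_risk p C n (deconv_estimator p n) \<le> ennreal (K / (2 * pi) / real n)"
    using eventually_gt_at_top[of 0]
  proof eventually_elim
    case (elim n)
    then show ?case
      using sup_risk_deconv_le[OF assms elim, of C] K by (simp add: divide_ennreal)
  qed
  then show ?thesis
    unfolding parametric_rate_def by blast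
qed

lemma segment_gap_pos:
  assumes "f0 \<noteq> f1"
  shows "segment_gap f0 f1 > 0"
proof -
  obtain k where k: "pmf f0 k \<noteq> pmf f1 k"
    using assms by (auto simp: pmf_eq_iff)
  have "(\<Sum>l\<in>{k}. (pmf f1 l - pmf f0 l)\<^sup>2) \<le> segment_gap f0 f1"
    unfolding segment_gap_def by (rule finite_sum_le_infsum[OF summable_on_sq_diff_pmf]) auto
  then show ?thesis
    using k by (simp add: less_le_trans[of 0 "(pmf f1 k - pmf f0 k)\<^sup>2"])
qed

lemma liminf_minimax_risk_pos:
  assumes "f0 \<noteq> f1" "pmf_segment f0 f1 \<subseteq> C"
  shows "liminf (\<lambda>n. of_nat n * minimax_risk p C n) > 0"
proof -
  define c0 c1 where "c0 = segment_gap f0 f1" and "c1 = obs_gap p f0 f1"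
  have c0: "c0 > 0"
    unfolding c0_def using assms(1) by (rule segment_gap_pos)
  have c1: "c1 \<ge> 0"
    by (simp add: c1_def obs_gap_def infsum_nonneg)
  have "\<forall>\<^sub>F n in sequentially. ennreal (c0 / (16 + 16 * c1)) \<le> of_nat n * minimax_risk p C n"
    using eventually_gt_at_top[of 0]
  proof eventually_elim
    case (elim n)
    define b where "b = 16 + 16 * c1 * real n"
    \<comment> \<open>Since \<open>n \<ge> 1\<close>, the constant term 16 is at most
      \<open>16 * real n\<close>; this makes the lower bound on the rescaled risk independent of
      \<open>n\<close>.\<close>
    have b: "0 < b" "b \<le> real n * (16 + 16 * c1)"
      using c1 elim by (auto simp: b_def algebra_simps add_pos_nonneg)
    have "c0 / (16 + 16 * c1) = real n * c0 / (real n * (16 + 16 * c1))"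
      using elim by simp
    also have "\<dots> \<le> real n * c0 / b"
      using b c0 c1 elim by (intro divide_left_mono mult_pos_pos) (auto simp: add_pos_nonneg)
    finally have "c0 / (16 + 16 * c1) \<le> real n * (c0 * inverse (16 + 16 * c1 * real n))"
      by (simp add: b_def divide_inverse)
    then have "ennreal (c0 / (16 + 16 * c1)) \<le> ennreal (real n * (c0 * inverse (16 + 16 * c1 * real n)))"
      by (rule ennreal_leI)
    also have "\<dots> = of_nat n * ennreal (c0 * inverse (16 + 16 * c1 * real n))"
      using c0 c1 by (simp add: ennreal_mult ennreal_of_nat_eq_real_of_nat)
    also have "\<dots> \<le> of_nat n * minimax_risk p C n"
      unfolding c0_def c1_def
      using order_trans[OF minimax_risk_segment_ge[OF elim] minimax_risk_mono[OF assms(2)]]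
      by (rule mult_left_mono) simp
    finally show ?case .
  qed
  then have "ennreal (c0 / (16 + 16 * c1)) \<le> liminf (\<lambda>n. of_nat n * minimax_risk p C n)"
    by (rule Liminf_bounded)
  moreover have "0 < ennreal (c0 / (16 + 16 * c1))"
    using c0 c1 by (simp add: add_pos_nonneg)
  ultimately show ?thesis
    by (rule less_le_trans[rotated])
qed

theorem theorem4:
  shows "(\<forall>p. deconv_const p < \<infinity> \<longrightarrow>
            parametric_rate p UNIV \<and>
            (\<forall>C. (\<exists>f0 f1. f0 \<noteq> f1 \<and> pmf_segment f0 f1 \<subseteq> C) \<longrightarrow> minimax_parametric_rate p C))
       \<and> (\<exists>K1>0::real. \<exists>K2>0::real. \<forall>p f0 f1. \<forall>n>0. deconv_const p < \<infinity> \<longrightarrow>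
            ennreal (segment_gap f0 f1 * inverse (K1 + K2 * obs_gap p f0 f1 * real n))
              \<le> minimax_risk p (pmf_segment f0 f1) n
          \<and> minimax_risk p (pmf_segment f0 f1) n \<le> sup_risk p UNIV n (deconv_estimator p n)
          \<and> sup_risk p UNIV n (deconv_estimator p n) \<le> deconv_const p / ennreal (2 * pi * real n))"
proof (intro conjI)
  show "\<forall>p. deconv_const p < \<infinity> \<longrightarrow> parametric_rate p UNIV \<and>
      (\<forall>C. (\<exists>f0 f1. f0 \<noteq> f1 \<and> pmf_segment f0 f1 \<subseteq> C) \<longrightarrow> minimax_parametric_rate p C)"
    unfolding minimax_parametric_rate_def
    by (auto intro: parametric_rate_deconv liminf_minimax_risk_pos)
  show "\<exists>K1>0::real. \<exists>K2>0::real. \<forall>p f0 f1. \<forall>n>0. deconv_const p < \<infinity> \<longrightarrow>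
      ennreal (segment_gap f0 f1 * inverse (K1 + K2 * obs_gap p f0 f1 * real n))
        \<le> minimax_risk p (pmf_segment f0 f1) n
    \<and> minimax_risk p (pmf_segment f0 f1) n \<le> sup_risk p UNIV n (deconv_estimator p n)
    \<and> sup_risk p UNIV n (deconv_estimator p n) \<le> deconv_const p / ennreal (2 * pi * real n)"
    by (intro exI[of _ 16] conjI allI impI)
       (simp_all add: minimax_risk_segment_ge minimax_risk_le_deconv sup_risk_deconv_le)
qed

end
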